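(* If $\ell_{\boldsymbol S}(j)=\ell_{\boldsymbol T}(j)$ for every $j\in C_d$, then there is a unique isomorphism $$\varphi:Y_{\boldsymbol S}\xrightarrow{\ \sim\ }Y_{\boldsymbol T},\qquad \varphi\circ f_{\boldsymbol S}=f_{\boldsymbol T}.$$ If every $n_\nu\ge d$, the converse holds: the existence of an isomorphism $\varphi$ with $\varphi\circ f_{\boldsymbol S}=f_{\boldsymbol T}$ implies $\ell_{\boldsymbol S}(j)=\ell_{\boldsymbol T}(j)$ for every $j\in C_d$. If the weight vectors $(|S_\nu|)_\nu$ and $(|T_\nu|)_\nu$ are already known to be proportional, the converse requires only $n_\nu\ge b(d)$ for all $\nu$.
   Context: $K$ is an algebraically closed field of characteristic zero, $d\ge2$, $\zeta\in K$ is a fixed primitive $d$th root of unity, $C_d=\mathbb Z/d\mathbb Z$. A subset of $C_d$ (mask) is aperiodic if no nonidentity translation fixes it; two masks are rotation-equivalent if one is a translate of the other. $b(d)=d/p_{\min}(d)$, where $p_{\min}(d)$ is the smallest prime factor of $d$. Let $\boldsymbol S=(S_1,\dots,S_t)$ and $\boldsymbol T=(T_1,\dots,T_t)$ be ordered lists of nonempty aperiodic masks in $C_d$; within each list no two masks are rotation-equivalent. Fix positive multiplicities $n_1,\dots,n_t$ (the same for both lists) and put $\mathcal N=\prod_{\nu=1}^t\operatorname{Sym}^{n_\nu}\mathbb P^1=\prod_{\nu=1}^t\mathbb P^{n_\nu}$. Define $$f_{\boldsymbol S}:\mathcal N\to Y_{\boldsymbol S},\qquad ([u_{\nu,i}:v_{\nu,i}])\mapsto\Big[\prod_{\nu,i}\prod_{a\in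 S_\nu}(v_{\nu,i}X-\zeta^au_{\nu,i}Z)\Big],$$ where $Y_{\boldsymbol S}$ is the reduced image in the projective space of binary forms of degree $\sum_\nu n_\nu|S_\nu|$; $f_{\boldsymbol S}$ is the normalization of $Y_{\boldsymbol S}$. Define $f_{\boldsymbol T}:\mathcal N\to Y_{\boldsymbol T}$ in the same way. Put $\lambda^{\boldsymbol S}_{\nu,j}=\sum_{a\in S_\nu}\zeta^{aj}$ and let $$\ell_{\boldsymbol S}(j)=K\cdot(\lambda^{\boldsymbol S}_{1,j},\dots,\lambda^{\boldsymbol S}_{t,j})\subset K^t,\qquad j\in C_d,$$ a line or the zero subspace; similarly $\ell_{\boldsymbol T}(j)$. *)

theory Defs
  imports "HOL-Computational_Algebra.Computational_Algebra" "HOL-Library.Poly_Mapping"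
    "HOL-Library.FuncSet"
begin

text \<open>Varieties over an algebraically closed field are treated classically, through their points.\<close>

section \<open>Projective space, regular maps and isomorphisms\<close>

text \<open>
  A point of \<open>P^m\<close> is the set of all its homogeneous coordinate vectors, that is, a punctured
  line. Coordinate vectors \<open>(x 0, ..., x m)\<close> are functions on \<^typ>\<open>nat\<close> vanishing beyond \<open>m\<close>.
\<close>

type_synonym 'a ppoint = "(nat \<Rightarrow> 'a) set"

definition proj_class :: "(nat \<Rightarrow> 'a::field) \<Rightarrow> 'a ppoint" where
  "proj_class x = {(\<lambda>i. c * x i) | c. c \<noteq> 0}"

definition proj_space :: "nat \<Rightarrow> 'a::field ppoint set" where
  "proj_space m = {proj_class x | x. (\<exists>i. x i \<noteq> 0) \<and> (\<forall>i>m. x i = 0)}"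

text \<open>Polynomials in variables indexed by \<^typ>\<open>nat\<close>: finitely supported maps from exponent
  vectors to coefficients.\<close>

type_synonym 'a mpolynomial = "(nat \<Rightarrow>\<^sub>0 nat) \<Rightarrow>\<^sub>0 'a"

definition mpoly_eval :: "'a::comm_semiring_1 mpolynomial \<Rightarrow> (nat \<Rightarrow> 'a) \<Rightarrow> 'a" where
  "mpoly_eval F x =
     (\<Sum>e\<in>Poly_Mapping.keys F.
        Poly_Mapping.lookup F e * (\<Prod>i\<in>Poly_Mapping.keys e. x i ^ Poly_Mapping.lookup e i))"

definition homogeneous_polys :: "nat \<Rightarrow> nat \<Rightarrow> 'a::comm_semiring_1 mpolynomial set" where
  "homogeneous_polys m r =
     {F. \<forall>e\<in>Poly_Mapping.keys F.
           Poly_Mapping.keys e \<subseteq> {..m} \<and> (\<Sum>i\<le>m. Poly_Mapping.lookup e i) = r}"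

definition zariski_open :: "nat \<Rightarrow> 'a::field ppoint set \<Rightarrow> bool" where
  "zariski_open m U \<longleftrightarrow>
     (\<exists>\<G> \<subseteq> (\<Union>r. homogeneous_polys m r).
        U = {p \<in> proj_space m. \<exists>G\<in>\<G>. \<forall>x\<in>p. mpoly_eval G x \<noteq> 0})"

text \<open>
  Morphisms between reduced locally closed subsets \<open>Y\<close> of \<open>P^m\<close> and \<open>Z\<close> of \<open>P^k\<close>: locally on
  \<open>Y\<close> they are given by \<open>k + 1\<close> forms of equal degree without common zeros.
\<close>

definition regular_map ::
  "nat \<Rightarrow> nat \<Rightarrow> 'a::field ppoint set \<Rightarrow> 'a ppoint set \<Rightarrow> ('a ppoint \<Rightarrow> 'a ppoint) \<Rightarrow> bool" where
  "regular_map m k Y Z \<phi> \<longleftrightarrow>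
     \<phi> \<in> Y \<rightarrow> Z \<and>
     (\<forall>p\<in>Y. \<exists>U r F.
        zariski_open m U \<and> p \<in> U \<and> (\<forall>i\<le>k. F i \<in> homogeneous_polys m r) \<and>
        (\<forall>q\<in>Y \<inter> U. \<forall>x\<in>q.
           (\<exists>i\<le>k. mpoly_eval (F i) x \<noteq> 0) \<and>
           \<phi> q = proj_class (\<lambda>i. if i \<le> k then mpoly_eval (F i) x else 0)))"

definition variety_iso ::
  "nat \<Rightarrow> nat \<Rightarrow> 'a::field ppoint set \<Rightarrow> 'a ppoint set \<Rightarrow> ('a ppoint \<Rightarrow> 'a ppoint) \<Rightarrow> bool" where
  "variety_iso m k Y Z \<phi> \<longleftrightarrow>
     bij_betw \<phi> Y Z \<and> regular_map m k Y Z \<phi> \<and> regular_map k m Z Y (inv_into Y \<phi>)"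

section \<open>Masks\<close>

text \<open>\<open>C\<^sub>d\<close> is represented by the residues \<open>{..<d}\<close> with addition modulo \<open>d\<close>.\<close>

definition translate :: "nat \<Rightarrow> nat \<Rightarrow> nat set \<Rightarrow> nat set" where
  "translate d s M = (\<lambda>a. (a + s) mod d) ` M"

definition aperiodic :: "nat \<Rightarrow> nat set \<Rightarrow> bool" where
  "aperiodic d M \<longleftrightarrow> (\<forall>s. 0 < s \<and> s < d \<longrightarrow> translate d s M \<noteq> M)"

definition rotation_equivalent :: "nat \<Rightarrow> nat set \<Rightarrow> nat set \<Rightarrow> bool" where
  "rotation_equivalent d M M' \<longleftrightarrow> (\<exists>s<d. M' = translate d s M)"

definition mask_list :: "nat \<Rightarrow> nat set list \<Rightarrow> bool" where
  "mask_list d S \<longleftrightarrow>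
     (\<forall>M\<in>set S. M \<subseteq> {..<d} \<and> M \<noteq> {} \<and> aperiodic d M) \<and>
     (\<forall>\<mu><length S. \<forall>\<nu><length S. \<mu> \<noteq> \<nu> \<longrightarrow> \<not> rotation_equivalent d (S ! \<mu>) (S ! \<nu>))"

definition primitive_root_of_unity :: "nat \<Rightarrow> 'a::field \<Rightarrow> bool" where
  "primitive_root_of_unity d \<zeta> \<longleftrightarrow> \<zeta> ^ d = 1 \<and> (\<forall>k. 0 < k \<and> k < d \<longrightarrow> \<zeta> ^ k \<noteq> 1)"

definition b_bound :: "nat \<Rightarrow> nat" where
  "b_bound d = d div Min (prime_factors d)"

definition mask_lambda :: "'a::field \<Rightarrow> nat set \<Rightarrow> nat \<Rightarrow> 'a" where
  "mask_lambda \<zeta> M j = (\<Sum>a\<in>M. \<zeta> ^ (a * j))"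

text \<open>Vectors of \<open>K^t\<close> are lists of length \<open>t\<close>.\<close>

definition lambda_line :: "'a::field \<Rightarrow> nat set list \<Rightarrow> nat \<Rightarrow> 'a list set" where
  "lambda_line \<zeta> S j = {map (\<lambda>M. c * mask_lambda \<zeta> M j) S | c. True}"

section \<open>The map \<open>f\<^sub>S\<close> and its image\<close>

text \<open>\<open>Sym^n P^1\<close> consists of the multisets of \<open>n\<close> points of \<open>P^1\<close>.\<close>

definition sym_product :: "nat list \<Rightarrow> 'a::field ppoint multiset list set" where
  "sym_product n =
     {D. length D = length n \<and>
         (\<forall>\<nu><length n. size (D ! \<nu>) = n ! \<nu> \<and> set_mset (D ! \<nu>) \<subseteq> proj_space 1)}"

text \<open>Binary forms live in \<open>K[Z][X]\<close>: the outer variable is \<open>X\<close>, the inner one is \<open>Z\<close>.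
  The form below is \<open>v X - \<zeta>^a u Z\<close>.\<close>

definition linear_form :: "'a::field \<Rightarrow> nat \<Rightarrow> 'a \<Rightarrow> 'a \<Rightarrow> 'a poly poly" where
  "linear_form \<zeta> a u v = [: [: 0, - (\<zeta> ^ a * u) :], [: v :] :]"

text \<open>Homogeneous coordinates \<open>[u : v]\<close> of each point are chosen arbitrarily; another choice
  multiplies the product by a nonzero constant.\<close>

definition mask_form :: "'a::field \<Rightarrow> nat set list \<Rightarrow> 'a ppoint multiset list \<Rightarrow> 'a poly poly" where
  "mask_form \<zeta> S D =
     (\<Prod>\<nu><length S. \<Prod>p\<in>#D ! \<nu>. \<Prod>a\<in>S ! \<nu>.
        (let x = (SOME x. x \<in> p) in linear_form \<zeta> a (x 0) (x 1)))"

definition form_degree :: "nat list \<Rightarrow> nat set list \<Rightarrow> nat" where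
  "form_degree n S = (\<Sum>\<nu><length S. n ! \<nu> * card (S ! \<nu>))"

text \<open>The class of a binary form of degree \<open>m\<close> in \<open>P^m\<close>; its \<open>k\<close>-th coordinate is the
  coefficient of \<open>X^k Z^(m - k)\<close>.\<close>

definition form_class :: "nat \<Rightarrow> 'a::field poly poly \<Rightarrow> 'a ppoint" where
  "form_class m F = proj_class (\<lambda>k. if k \<le> m then coeff (coeff F k) (m - k) else 0)"

definition mask_map ::
  "'a::field \<Rightarrow> nat list \<Rightarrow> nat set list \<Rightarrow> 'a ppoint multiset list \<Rightarrow> 'a ppoint" where
  "mask_map \<zeta> n S D = form_class (form_degree n S) (mask_form \<zeta> S D)"

text \<open>The image is already Zariski closed because \<open>sym_product n\<close> is projective, so no closure is
  taken.\<close>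

definition mask_variety :: "'a::field \<Rightarrow> nat list \<Rightarrow> nat set list \<Rightarrow> 'a ppoint set" where
  "mask_variety \<zeta> n S = mask_map \<zeta> n S ` sym_product n"

definition compatible_iso ::
  "'a::field \<Rightarrow> nat list \<Rightarrow> nat set list \<Rightarrow> nat set list \<Rightarrow> ('a ppoint \<Rightarrow> 'a ppoint) \<Rightarrow> bool" where
  "compatible_iso \<zeta> n S T \<phi> \<longleftrightarrow>
     variety_iso (form_degree n S) (form_degree n T) (mask_variety \<zeta> n S) (mask_variety \<zeta> n T) \<phi> \<and>
     (\<forall>D\<in>sym_product n. \<phi> (mask_map \<zeta> n S D) = mask_map \<zeta> n T D)"

end

theory Submission
  imports Defs
begin

text \<open>
  Setting \<open>Z = 1\<close> turns the forms \<open>f\<^sub>S(D)\<close> and \<open>f\<^sub>T(D)\<close> of a point \<open>D\<close> into polynomials \<open>P\<close> and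
  \<open>Q\<close> in one variable. Both directions compare these two polynomials.

  \<^emph>\<open>From lines to an isomorphism.\<close> A point \<open>[u : v]\<close> of \<open>D\<close> with mask \<open>M\<close> contributes
  \<open>\<Sum>a\<in>M. h(a)\<close> to the logarithmic derivative \<open>X P'/P\<close>, where \<open>h(k) = v X / (v X - \<zeta>^k u)\<close> is a
  function on \<open>C\<^sub>d\<close>. If \<open>\<lambda>\<^sup>T\<close> is proportional to \<open>\<lambda>\<^sup>S\<close> in every frequency, Fourier inversion
  writes the indicator functions of all masks of \<open>T\<close> as convolutions of those of \<open>S\<close> with one and
  the same function \<open>\<gamma>\<close> (\<open>mask_sum_transfer\<close>). Rotating \<open>X\<close> by \<open>\<zeta>\<close> translates \<open>h\<close>, so
  \<open>X Q'/Q = \<Sum>b<d. \<gamma>\<^sub>b (X P'/P)(\<zeta>^(-b) X)\<close>.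
  Cleared of denominators this is a system of linear equations for the coefficients of \<open>Q\<close> whose
  entries are forms of degree \<open>d\<close> in the coefficients of \<open>P\<close> (\<open>ode_mask_poly\<close>). In characteristic
  zero a polynomial is determined up to a scalar by its logarithmic derivative, so at every point of
  \<open>Y\<^sub>S\<close>, including the degenerate ones with roots at \<open>0\<close> and \<open>\<infinity>\<close>, the solution space is exactly
  a line (\<open>ode_solution_unique\<close>). Hence \<open>f\<^sub>S(D)\<close> determines \<open>f\<^sub>T(D)\<close>, and solving the
  system without divisions (\<open>form_elimination\<close>) gives, near each point, forms in the coefficients of
  \<open>P\<close> which are homogeneous coordinates of \<open>f\<^sub>T(D)\<close>. The situation is symmetric in \<open>S\<close> and \<open>T\<close>.

  \<^emph>\<open>From an isomorphism to lines.\<close> Let \<open>1 \<le> j \<le> n\<^sub>\<nu>\<close> for all \<open>\<nu>\<close> and let \<open>w\<close> be a vector with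
  \<open>\<Sum>\<nu>. w\<^sub>\<nu> \<lambda>\<^sup>S\<^sub>\<nu> = 0\<close> in frequency \<open>j\<close>. On the curve in the product of symmetric powers whose
  \<open>\<nu>\<close>-th component at time \<open>s\<close> consists of the \<open>j\<close>-th roots of \<open>w\<^sub>\<nu> s\<close> and zeros, the form \<open>f\<^sub>T\<close> is
  \<open>X^k - s (\<Sum>\<nu>. w\<^sub>\<nu> \<lambda>\<^sup>T\<^sub>\<nu>) X^(k-j) Z^j\<close> modulo \<open>s^2\<close>, and in the same way \<open>f\<^sub>S\<close> is stationary to
  first order. A map given near the point \<open>s = 0\<close> by polynomials in coordinates cannot turn a
  stationary curve into a moving one, so \<open>\<Sum>\<nu>. w\<^sub>\<nu> \<lambda>\<^sup>T\<^sub>\<nu> = 0\<close> (\<open>regular_map_first_order\<close>).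
  Applied to the isomorphism and its inverse this gives \<open>\<ell>\<^sub>S(j) = \<ell>\<^sub>T(j)\<close>.

  \<^emph>\<open>The range of frequencies.\<close> If all \<open>n\<^sub>\<nu> \<ge> d\<close>, then \<open>j = 1, ..., d\<close> covers \<open>C\<^sub>d\<close>. If the weights
  are proportional, \<open>j = 0\<close> is clear, and every other \<open>j\<close> is reached from the proper divisor
  \<open>gcd j d \<le> b(d)\<close>: \<open>\<zeta>^j\<close> is a power of \<open>\<zeta>^(gcd j d)\<close> with exponent prime to its order, and
  polynomial relations with integer coefficients pass to such conjugates
  (\<open>int_poly_conjugate_root_of_unity\<close>, the irreducibility of cyclotomic polynomials).
\<close>

section \<open>Forms as functions\<close>

definition monomial_value :: "(nat \<Rightarrow>\<^sub>0 nat) \<Rightarrow> (nat \<Rightarrow> 'a::comm_semiring_1) \<Rightarrow> 'a" where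
  "monomial_value e x = (\<Prod>i\<in>Poly_Mapping.keys e. x i ^ Poly_Mapping.lookup e i)"

lemma monomial_value_superset:
  assumes "finite A" "Poly_Mapping.keys e \<subseteq> A"
  shows "monomial_value e x = (\<Prod>i\<in>A. x i ^ Poly_Mapping.lookup e i)"
  unfolding monomial_value_def using assms
  by (intro prod.mono_neutral_left) (auto simp: in_keys_iff)

lemma monomial_value_add: "monomial_value (e + f) x = monomial_value e x * monomial_value f x"
proof -
  let ?A = "Poly_Mapping.keys e \<union> Poly_Mapping.keys f"
  have "finite ?A" "Poly_Mapping.keys (e + f) \<subseteq> ?A" using Poly_Mapping.keys_add[of e f] by auto
  then show ?thesis
    by (simp add: monomial_value_superset[of ?A] lookup_add power_add prod.distrib)
qed

lemma mpoly_eval_superset: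
  assumes "finite A" "Poly_Mapping.keys F \<subseteq> A"
  shows "mpoly_eval F x = (\<Sum>e\<in>A. Poly_Mapping.lookup F e * monomial_value e x)"
  unfolding mpoly_eval_def monomial_value_def[symmetric] using assms
  by (intro sum.mono_neutral_left) (auto simp: in_keys_iff)

lemma mpoly_eval_add: "mpoly_eval (F + G) x = mpoly_eval F x + mpoly_eval G x"
proof -
  let ?A = "Poly_Mapping.keys F \<union> Poly_Mapping.keys G"
  have "finite ?A" "Poly_Mapping.keys (F + G) \<subseteq> ?A" using Poly_Mapping.keys_add[of F G] by auto
  then show ?thesis
    by (simp add: mpoly_eval_superset[of ?A] lookup_add sum.distrib distrib_right)
qed

text \<open>
  A form is identified with the function that it defines on coordinate vectors; sums and products of
  functions then replace computations with exponent vectors.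
\<close>

definition form_functions :: "nat \<Rightarrow> nat \<Rightarrow> ((nat \<Rightarrow> 'a::comm_semiring_1) \<Rightarrow> 'a) set" where
  "form_functions m r = mpoly_eval ` homogeneous_polys m r"

lemma form_function_zero [simp]: "(\<lambda>x. 0) \<in> form_functions m r"
proof -
  have "mpoly_eval (0 :: 'a mpolynomial) = (\<lambda>x. 0)" by (simp add: mpoly_eval_def fun_eq_iff)
  moreover have "0 \<in> homogeneous_polys m r" by (simp add: homogeneous_polys_def)
  ultimately show ?thesis unfolding form_functions_def by (metis imageI)
qed

lemma form_function_add:
  assumes "f \<in> form_functions m r" "g \<in> form_functions m r"
  shows "(\<lambda>x. f x + g x) \<in> form_functions m r"
proof -
  obtain F G where FG: "F \<in> homogeneous_polys m r" "f = mpoly_eval F"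
    "G \<in> homogeneous_polys m r" "g = mpoly_eval G"
    using assms by (auto simp: form_functions_def)
  have "F + G \<in> homogeneous_polys m r"
    using FG(1,3) Poly_Mapping.keys_add[of F G] unfolding homogeneous_polys_def by blast
  moreover have "mpoly_eval (F + G) = (\<lambda>x. f x + g x)" by (simp add: FG fun_eq_iff mpoly_eval_add)
  ultimately show ?thesis unfolding form_functions_def by (metis imageI)
qed

lemma form_function_sum:
  assumes "\<And>i. i \<in> A \<Longrightarrow> f i \<in> form_functions m r"
  shows "(\<lambda>x. \<Sum>i\<in>A. f i x) \<in> form_functions m r"
  using assms by (induction A rule: infinite_finite_induct) (auto intro: form_function_add)

lemma form_function_monomial:
  assumes "Poly_Mapping.keys e \<subseteq> {..m}" "(\<Sum>i\<le>m. Poly_Mapping.lookup e i) = r"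
  shows "(\<lambda>x. c * monomial_value e x) \<in> form_functions m r"
proof -
  have "Poly_Mapping.single e c \<in> homogeneous_polys m r"
    using assms by (simp add: homogeneous_polys_def)
  moreover have "mpoly_eval (Poly_Mapping.single e c) = (\<lambda>x. c * monomial_value e x)"
    by (rule ext) (subst mpoly_eval_superset[of "{e}"]; simp)
  ultimately show ?thesis unfolding form_functions_def by (metis imageI)
qed

text \<open>
  Any form with the right values serves, so the products of monomials are summed directly.
\<close>

lemma form_function_mult:
  fixes f g :: "(nat \<Rightarrow> 'a::comm_semiring_1) \<Rightarrow> 'a"
  assumes "f \<in> form_functions m r" "g \<in> form_functions m s"
  shows "(\<lambda>x. f x * g x) \<in> form_functions m (r + s)"
proof -
  obtain F G where FG: "F \<in> homogeneous_polys m r" "f = mpoly_eval F"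
    "G \<in> homogeneous_polys m s" "g = mpoly_eval G"
    using assms by (auto simp: form_functions_def)
  let ?term = "\<lambda>e e'. \<lambda>x. (Poly_Mapping.lookup F e * Poly_Mapping.lookup G e') * monomial_value (e + e') x"
  have "?term e e' \<in> form_functions m (r + s)"
    if "e \<in> Poly_Mapping.keys F" "e' \<in> Poly_Mapping.keys G" for e e'
  proof (rule form_function_monomial)
    have "Poly_Mapping.keys e \<subseteq> {..m}" "Poly_Mapping.keys e' \<subseteq> {..m}"
      using FG(1,3) that unfolding homogeneous_polys_def by blast+
    then show "Poly_Mapping.keys (e + e') \<subseteq> {..m}" using Poly_Mapping.keys_add[of e e'] by blast
    show "(\<Sum>i\<le>m. Poly_Mapping.lookup (e + e') i) = r + s"
      using FG(1,3) that unfolding homogeneous_polys_def by (simp add: lookup_add sum.distrib)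
  qed
  then have "(\<lambda>x. \<Sum>e\<in>Poly_Mapping.keys F. \<Sum>e'\<in>Poly_Mapping.keys G. ?term e e' x) \<in> form_functions m (r + s)"
    by (intro form_function_sum)
  moreover have "(\<lambda>x. f x * g x) = (\<lambda>x. \<Sum>e\<in>Poly_Mapping.keys F. \<Sum>e'\<in>Poly_Mapping.keys G. ?term e e' x)"
    by (rule ext)
       (simp add: FG mpoly_eval_superset[OF finite_keys subset_refl] sum_product monomial_value_add mult_ac)
  ultimately show ?thesis by simp
qed

lemma form_function_const: "(\<lambda>x. c) \<in> form_functions m 0"
  using form_function_monomial[of 0 m 0 c] by (simp add: monomial_value_def)

lemma form_function_scale:
  assumes "f \<in> form_functions m r"
  shows "(\<lambda>x. c * f x) \<in> form_functions m r"
  using form_function_mult[OF form_function_const[of c] assms] by simp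

lemma form_function_var: "i \<le> m \<Longrightarrow> (\<lambda>x. x i) \<in> form_functions m 1"
  using form_function_monomial[of "Poly_Mapping.single i 1" m 1 1]
  by (simp add: monomial_value_def lookup_single when_def)

lemma form_function_diff:
  fixes f g :: "(nat \<Rightarrow> 'a::comm_ring_1) \<Rightarrow> 'a"
  assumes "f \<in> form_functions m r" "g \<in> form_functions m r"
  shows "(\<lambda>x. f x - g x) \<in> form_functions m r"
  using form_function_add[OF assms(1) form_function_scale[OF assms(2), of "- 1"]] by simp

lemma form_function_homogeneous:
  assumes "f \<in> form_functions m r"
  shows "f (\<lambda>i. c * x i) = c ^ r * f x"
proof -
  obtain F where F: "F \<in> homogeneous_polys m r" "f = mpoly_eval F"
    using assms by (auto simp: form_functions_def)
  have "monomial_value e (\<lambda>i. c * x i) = c ^ r * monomial_value e x" if "e \<in> Poly_Mapping.keys F" for e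
  proof -
    have "Poly_Mapping.keys e \<subseteq> {..m}" "(\<Sum>i\<le>m. Poly_Mapping.lookup e i) = r"
      using F(1) that unfolding homogeneous_polys_def by auto
    then show ?thesis
      by (simp add: monomial_value_superset[of "{..m}"] power_mult_distrib prod.distrib
          flip: power_sum)
  qed
  then show ?thesis
    by (simp add: F mpoly_eval_superset[OF finite_keys subset_refl] sum_distrib_left mult_ac)
qed

section \<open>Elimination with forms\<close>

text \<open>
  Gaussian elimination without divisions. A linear system whose entries are forms and whose solution
  space at \<open>x0\<close> is at most a line has, near \<open>x0\<close>, solution spaces contained in the line through a
  vector of forms \<open>G\<close>. The pivot \<open>A l i\<close> is chosen not to vanish at \<open>x0\<close>; cross multiplication with
  it removes the unknown \<open>i\<close>, and \<open>g\<close> collects the pivots.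
\<close>

lemma form_elimination:
  fixes A :: "'l \<Rightarrow> 'i \<Rightarrow> (nat \<Rightarrow> 'a::field) \<Rightarrow> 'a"
  assumes "finite I" "I \<noteq> {}"
    and "\<And>l i. i \<in> I \<Longrightarrow> A l i \<in> form_functions m r"
    and "\<And>e. \<forall>l. (\<Sum>i\<in>I. A l i x0 * e i) = 0 \<Longrightarrow> \<exists>c. \<forall>i\<in>I. e i = c * e0 i"
  shows "\<exists>q s g G. g \<in> form_functions m q \<and> g x0 \<noteq> 0 \<and> (\<forall>i\<in>I. G i \<in> form_functions m s) \<and>
    (\<forall>x e. g x \<noteq> 0 \<longrightarrow> (\<forall>l. (\<Sum>i\<in>I. A l i x * e i) = 0) \<longrightarrow> (\<exists>c. \<forall>i\<in>I. e i = c * G i x))"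
  using assms
proof (induction "card I" arbitrary: I A r rule: less_induct)
  case less
  note fin = less.prems(1) and forms = less.prems(3) and unique = less.prems(4)
  obtain j where j: "j \<in> I" using less.prems(2) by blast
  show ?case
  proof (cases "I = {j}")
    case True
    show ?thesis
    proof (intro exI conjI ballI allI impI)
      show "(\<lambda>x. 1) \<in> form_functions m 0" by (rule form_function_const)
      show "(\<lambda>x. 1) \<in> form_functions m 0" by (rule form_function_const)
      show "e i = e j * 1" if "i \<in> I" for e :: "'i \<Rightarrow> 'a" and i using that True by simp
    qed simp
  next
    case False
    then obtain k where k: "k \<in> I" "k \<noteq> j" using j by blast
    obtain l i where li: "i \<in> I" "A l i x0 \<noteq> 0"
    proof (rule ccontr)
      assume "\<not> thesis"
      then have zero: "\<And>l i. i \<in> I \<Longrightarrow> A l i x0 = 0" using that by blast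
      have all: "\<exists>c. \<forall>i\<in>I. e i = c * e0 i" for e
        using unique[of e] zero by simp
      obtain c where c: "\<forall>i\<in>I. (if i = j then 1 else 0) = c * e0 i"
        using all[of "\<lambda>i. if i = j then 1 else 0"] by blast
      obtain c' where c': "\<forall>i\<in>I. (if i = k then 1 else 0) = c' * e0 i"
        using all[of "\<lambda>i. if i = k then 1 else 0"] by blast
      have "1 = c * e0 j" "0 = c * e0 k" "1 = c' * e0 k"
        using c c' j k by fastforce+
      then show False by auto
    qed
    define I' where "I' = I - {i}"
    \<comment> \<open>Row \<open>l'\<close> after elimination of the unknown \<open>i\<close> with the pivot row \<open>l\<close>.\<close>
    define B where "B l' i' x = A l i x * A l' i' x - A l' i x * A l i' x" for l' i' x
    have I: "I = insert i I'" "i \<notin> I'" "finite I'" using li(1) fin by (auto simp: I'_def)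
    have "I' \<noteq> {}" using j k unfolding I'_def by blast
    have split: "(\<Sum>h\<in>I. u h) = u i + (\<Sum>h\<in>I'. u h)" for u :: "'i \<Rightarrow> 'a"
      using I by simp
    have B_sum: "(\<Sum>h\<in>I'. B l' h x * e h)
        = A l i x * (\<Sum>h\<in>I. A l' h x * e h) - A l' i x * (\<Sum>h\<in>I. A l h x * e h)" for l' x e
      by (simp add: B_def split left_diff_distrib sum_subtractf sum_distrib_left algebra_simps)
    have "\<exists>q s g G. g \<in> form_functions m q \<and> g x0 \<noteq> 0 \<and> (\<forall>h\<in>I'. G h \<in> form_functions m s) \<and>
      (\<forall>x e. g x \<noteq> 0 \<longrightarrow> (\<forall>l'. (\<Sum>h\<in>I'. B l' h x * e h) = 0) \<longrightarrow> (\<exists>c. \<forall>h\<in>I'. e h = c * G h x))"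
    proof (rule less.hyps[of _ _ "r + r"])
      show "card I' < card I" using I by simp
      show "B l' h \<in> form_functions m (r + r)" if "h \<in> I'" for l' h
        unfolding B_def using that I(1) forms by (intro form_function_diff form_function_mult) auto
      show "\<exists>c. \<forall>h\<in>I'. e h = c * e0 h" if e: "\<forall>l'. (\<Sum>h\<in>I'. B l' h x0 * e h) = 0" for e
      proof -
        \<comment> \<open>A solution of the reduced system extends to the full one: row \<open>l\<close> is solved for \<open>e i\<close>.\<close>
        define e' where "e' = e(i := - (\<Sum>h\<in>I'. A l h x0 * e h) / A l i x0)"
        have e'_I': "(\<Sum>h\<in>I'. u h * e' h) = (\<Sum>h\<in>I'. u h * e h)" for u
          using I(2) by (intro sum.cong) (auto simp: e'_def)
        have row: "(\<Sum>h\<in>I. A l h x0 * e' h) = 0"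
          unfolding split e'_I' using li(2) by (simp add: e'_def)
        have "(\<Sum>h\<in>I. A l' h x0 * e' h) = 0" for l'
          using B_sum[of l' x0 e'] row e e'_I' li(2) by simp
        then obtain c where "\<forall>h\<in>I. e' h = c * e0 h" using unique by blast
        then have "\<forall>h\<in>I'. e h = c * e0 h" using I by (metis e'_def fun_upd_other insertI2)
        then show ?thesis by blast
      qed
    qed (use I \<open>I' \<noteq> {}\<close> in auto)
    then obtain q s g G where gG: "g \<in> form_functions m q" "g x0 \<noteq> 0"
      "\<And>h. h \<in> I' \<Longrightarrow> G h \<in> form_functions m s"
      "\<And>x e. g x \<noteq> 0 \<Longrightarrow> \<forall>l'. (\<Sum>h\<in>I'. B l' h x * e h) = 0 \<Longrightarrow> \<exists>c. \<forall>h\<in>I'. e h = c * G h x"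
      by blast
    \<comment> \<open>The extension of \<open>G\<close> by the pivot row, multiplied by the pivot to avoid the division.\<close>
    define G' where "G' h = (if h = i then (\<lambda>x. - 1 * (\<Sum>h\<in>I'. A l h x * G h x)) else (\<lambda>x. A l i x * G h x))" for h
    have sol: "\<exists>c. \<forall>h\<in>I. e h = c * G' h x"
      if x: "g x * A l i x \<noteq> 0" and e: "\<forall>l. (\<Sum>i\<in>I. A l i x * e i) = 0" for x e
    proof -
      have "\<forall>l'. (\<Sum>h\<in>I'. B l' h x * e h) = 0" using B_sum e by simp
      then obtain c where c: "\<forall>h\<in>I'. e h = c * G h x" using gG(4)[of x e] x by auto
      have "A l i x * e i = - (\<Sum>h\<in>I'. A l h x * e h)"
        using e[rule_format, of l] unfolding split by (simp add: eq_neg_iff_add_eq_0)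
      also have "(\<Sum>h\<in>I'. A l h x * e h) = c * (\<Sum>h\<in>I'. A l h x * G h x)"
        unfolding sum_distrib_left using c by (intro sum.cong) auto
      finally have "e i = c / A l i x * G' i x"
        using x by (simp add: G'_def field_simps)
      moreover have "e h = c / A l i x * G' h x" if "h \<in> I'" for h
        using that c x I by (auto simp: G'_def)
      ultimately have "\<forall>h\<in>I. e h = c / A l i x * G' h x" using I by blast
      then show ?thesis ..
    qed
    have G'_form: "G' h \<in> form_functions m (r + s)" if "h \<in> I" for h
    proof (cases "h = i")
      case True
      have "(\<lambda>x. - 1 * (\<Sum>h\<in>I'. A l h x * G h x)) \<in> form_functions m (r + s)"
        using I by (intro form_function_scale form_function_sum form_function_mult gG forms) auto
      then show ?thesis using True by (simp add: G'_def)
    next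
      case False
      have "(\<lambda>x. A l i x * G h x) \<in> form_functions m (r + s)"
        using that I False by (intro form_function_mult gG forms) auto
      then show ?thesis using False by (simp add: G'_def)
    qed
    have "(\<lambda>x. g x * A l i x) \<in> form_functions m (q + r)"
      by (intro form_function_mult gG forms li)
    moreover have "g x0 * A l i x0 \<noteq> 0" using gG(2) li(2) by simp
    ultimately show ?thesis using sol G'_form by blast
  qed
qed

section \<open>Dehomogenised mask forms\<close>

text \<open>
  The value at \<open>z\<close> of the inner variable. For \<open>z = 1\<close> this dehomogenises a binary form; below it also
  evaluates the parameter of a one-parameter family of polynomials.
\<close>

definition eval_inner :: "'a::comm_ring_1 \<Rightarrow> 'a poly poly \<Rightarrow> 'a poly" where
  "eval_inner z F = map_poly (\<lambda>q. poly q z) F"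

lemma coeff_eval_inner: "coeff (eval_inner z F) k = poly (coeff F k) z"
  by (simp add: eval_inner_def coeff_map_poly)

lemma eval_inner_mult: "eval_inner z (F * G) = eval_inner z F * eval_inner z G"
  by (rule poly_eqI) (simp add: coeff_eval_inner coeff_mult poly_sum)

lemma eval_inner_1: "eval_inner z 1 = 1"
  by (simp add: eval_inner_def)

lemma eval_inner_prod: "eval_inner z (prod f A) = (\<Prod>i\<in>A. eval_inner z (f i))"
  by (induction A rule: infinite_finite_induct) (simp_all add: eval_inner_1 eval_inner_mult)

lemma eval_inner_prod_mset: "eval_inner z (\<Prod>i\<in>#A. f i) = (\<Prod>i\<in>#A. eval_inner z (f i))"
  by (induction A) (simp_all add: eval_inner_1 eval_inner_mult)

definition binary_form :: "nat \<Rightarrow> 'a::comm_ring_1 poly poly \<Rightarrow> bool" where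
  "binary_form m F \<longleftrightarrow> (\<forall>k l. k + l \<noteq> m \<longrightarrow> coeff (coeff F k) l = 0)"

lemma binary_form_1: "binary_form 0 1"
  by (auto simp: binary_form_def)

lemma binary_form_mult:
  assumes "binary_form m F" "binary_form n G"
  shows "binary_form (m + n) (F * G)"
  unfolding binary_form_def
proof (intro allI impI)
  fix k l assume kl: "k + l \<noteq> m + n"
  have "coeff (coeff F i) j * coeff (coeff G (k - i)) (l - j) = 0" if "i \<le> k" "j \<le> l" for i j
  proof -
    have "i + j \<noteq> m \<or> (k - i) + (l - j) \<noteq> n" using kl that by linarith
    then show ?thesis using assms unfolding binary_form_def by auto
  qed
  then show "coeff (coeff (F * G) k) l = 0"
    by (simp add: coeff_mult coeff_sum)
qed

lemma binary_form_prod: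
  assumes "\<And>i. i \<in> A \<Longrightarrow> binary_form (m i) (f i)"
  shows "binary_form (\<Sum>i\<in>A. m i) (prod f A)"
  using assms
  by (induction A rule: infinite_finite_induct) (auto intro: binary_form_1 binary_form_mult)

lemma binary_form_prod_mset:
  assumes "\<And>i. i \<in># A \<Longrightarrow> binary_form m (f i)"
  shows "binary_form (size A * m) (\<Prod>i\<in>#A. f i)"
  using assms by (induction A) (auto intro: binary_form_1 binary_form_mult)

lemma binary_form_linear_form: "binary_form 1 (linear_form \<zeta> a u v)"
  by (auto simp: binary_form_def linear_form_def coeff_pCons split: nat.splits)

text \<open>
  Homogeneity is what makes dehomogenisation lossless: the coordinates of a form are the coefficients
  of the dehomogenised polynomial.
\<close>

lemma binary_form_coordinates:
  assumes "binary_form m F"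
  shows "form_class m F = proj_class (coeff (eval_inner 1 F))"
    and "k > m \<Longrightarrow> coeff (eval_inner 1 F) k = 0"
proof -
  have "coeff F k = (if k \<le> m then monom (coeff (coeff F k) (m - k)) (m - k) else 0)" for k
    using assms by (intro poly_eqI) (auto simp: binary_form_def)
  then have 1: "poly (coeff F k) 1 = (if k \<le> m then coeff (coeff F k) (m - k) else 0)" for k
    by (metis (no_types, lifting) mult.right_neutral poly_0 poly_monom power_one)
  then show "form_class m F = proj_class (coeff (eval_inner 1 F))"
    unfolding form_class_def coeff_eval_inner by (metis (no_types, lifting) ext)
  show "k > m \<Longrightarrow> coeff (eval_inner 1 F) k = 0" using 1[of k] by (simp add: coeff_eval_inner)
qed

text \<open>
  The same choice of homogeneous coordinates as in \<^const>\<open>mask_form\<close>.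
\<close>

definition point_coord :: "'a::field ppoint \<Rightarrow> nat \<Rightarrow> 'a" where
  "point_coord p = (SOME x. x \<in> p)"

definition mask_poly :: "'a::field \<Rightarrow> nat set list \<Rightarrow> 'a ppoint multiset list \<Rightarrow> 'a poly" where
  "mask_poly \<zeta> S D = (\<Prod>\<nu><length S. \<Prod>p\<in>#D ! \<nu>. \<Prod>a\<in>S ! \<nu>.
     [: - (\<zeta> ^ a * point_coord p 0), point_coord p 1 :])"

lemma eval_inner_mask_form: "eval_inner 1 (mask_form \<zeta> S D) = mask_poly \<zeta> S D"
proof -
  have "eval_inner 1 (linear_form \<zeta> a u v) = [: - (\<zeta> ^ a * u), v :]" for a and u v :: 'a
    by (simp add: eval_inner_def linear_form_def map_poly_pCons)
  then show ?thesis
    by (simp add: mask_form_def mask_poly_def eval_inner_prod eval_inner_prod_mset Let_def point_coord_def)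
qed

lemma binary_form_mask_form:
  assumes "D \<in> sym_product n" "length S = length n"
  shows "binary_form (form_degree n S) (mask_form \<zeta> S D)"
proof -
  have "binary_form (size (D ! \<nu>) * (\<Sum>a\<in>S ! \<nu>. 1)) (\<Prod>p\<in>#D ! \<nu>. \<Prod>a\<in>S ! \<nu>.
        (let x = (SOME x. x \<in> p) in linear_form \<zeta> a (x 0) (x 1)))" for \<nu>
    unfolding Let_def by (intro binary_form_prod_mset binary_form_prod binary_form_linear_form)
  then have "binary_form (\<Sum>\<nu><length S. size (D ! \<nu>) * (\<Sum>a\<in>S ! \<nu>. 1)) (mask_form \<zeta> S D)"
    unfolding mask_form_def by (intro binary_form_prod)
  also have "(\<Sum>\<nu><length S. size (D ! \<nu>) * (\<Sum>a\<in>S ! \<nu>. 1)) = form_degree n S"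
    using assms by (simp add: form_degree_def sym_product_def)
  finally show ?thesis .
qed

lemma proj_class_eq_iff:
  "proj_class x = proj_class y \<longleftrightarrow> (\<exists>c. c \<noteq> 0 \<and> x = (\<lambda>i. c * y i))"
proof
  assume eq: "proj_class x = proj_class y"
  have "x \<in> proj_class x" unfolding proj_class_def by (auto intro: exI[of _ 1])
  then show "\<exists>c. c \<noteq> 0 \<and> x = (\<lambda>i. c * y i)" unfolding eq by (auto simp: proj_class_def)
next
  assume "\<exists>c. c \<noteq> 0 \<and> x = (\<lambda>i. c * y i)"
  then obtain c where c: "c \<noteq> 0" "x = (\<lambda>i. c * y i)" by blast
  show "proj_class x = proj_class y"
  proof (intro set_eqI iffI)
    fix z assume "z \<in> proj_class x"
    then obtain b where "b \<noteq> 0" "z = (\<lambda>i. b * x i)" by (auto simp: proj_class_def)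
    then have "b * c \<noteq> 0" "z = (\<lambda>i. (b * c) * y i)" using c by (auto simp: mult.assoc)
    then show "z \<in> proj_class y" unfolding proj_class_def by blast
  next
    fix z assume "z \<in> proj_class y"
    then obtain b where "b \<noteq> 0" "z = (\<lambda>i. b * y i)" by (auto simp: proj_class_def)
    then have "b / c \<noteq> 0" "z = (\<lambda>i. (b / c) * x i)" using c by (auto simp: mult.assoc)
    then show "z \<in> proj_class x" unfolding proj_class_def by blast
  qed
qed

lemma proj_class_coeff_eq_iff:
  "proj_class (coeff P) = proj_class (coeff Q) \<longleftrightarrow> (\<exists>c. c \<noteq> 0 \<and> P = smult c Q)"
  unfolding proj_class_eq_iff by (simp add: poly_eq_iff fun_eq_iff)

lemma mem_proj_classD: "x \<in> proj_class y \<Longrightarrow> \<exists>c. c \<noteq> 0 \<and> x = (\<lambda>i. c * y i)"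
  by (auto simp: proj_class_def)

lemma self_mem_proj_class: "x \<in> proj_class x"
  unfolding proj_class_def by (auto intro: exI[of _ 1])

lemma point_coord_proj_class: "\<exists>c. c \<noteq> 0 \<and> point_coord (proj_class x) = (\<lambda>i. c * x i)"
  unfolding point_coord_def by (rule mem_proj_classD[OF someI[of "\<lambda>y. y \<in> proj_class x", OF self_mem_proj_class]])

lemma point_coord_nonzero:
  assumes "p \<in> proj_space 1"
  shows "point_coord p 0 \<noteq> 0 \<or> point_coord p 1 \<noteq> 0"
proof -
  obtain x where x: "p = proj_class x" "\<exists>i. x i \<noteq> 0" "\<forall>i>1. x i = 0"
    using assms by (auto simp: proj_space_def)
  obtain i where i: "x i \<noteq> 0" using x(2) by blast
  then have "i = 0 \<or> i = 1" using x(3) by (metis less_one linorder_neqE_nat)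
  then show ?thesis using i point_coord_proj_class[of x] x(1) by auto
qed

lemma mask_poly_nonzero:
  assumes "\<zeta> \<noteq> 0" "D \<in> sym_product n" "length S = length n"
  shows "mask_poly \<zeta> S D \<noteq> 0"
proof -
  have "[: - (\<zeta> ^ a * point_coord p 0), point_coord p 1 :] \<noteq> 0"
    if "\<nu> < length S" "p \<in># D ! \<nu>" for \<nu> a p
  proof -
    have "p \<in> proj_space 1" using assms that by (auto simp: sym_product_def)
    then show ?thesis using point_coord_nonzero[of p] assms(1) by auto
  qed
  then have "(\<Prod>a\<in>S ! \<nu>. [: - (\<zeta> ^ a * point_coord p 0), point_coord p 1 :]) \<noteq> 0"
    if "\<nu> < length S" "p \<in># D ! \<nu>" for \<nu> p
    using that by (cases "finite (S ! \<nu>)") auto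
  then show ?thesis
    unfolding mask_poly_def by (auto simp: prod_mset_zero_iff) 
qed

lemma mask_map_eq:
  assumes "D \<in> sym_product n" "length S = length n"
  shows "mask_map \<zeta> n S D = proj_class (coeff (mask_poly \<zeta> S D))"
    and "k > form_degree n S \<Longrightarrow> coeff (mask_poly \<zeta> S D) k = 0"
  using binary_form_coordinates[OF binary_form_mask_form[OF assms]]
  by (simp_all add: mask_map_def eval_inner_mask_form)

lemma mask_map_in_proj_space:
  assumes "\<zeta> \<noteq> 0" "D \<in> sym_product n" "length S = length n"
  shows "mask_map \<zeta> n S D \<in> proj_space (form_degree n S)"
  unfolding proj_space_def mask_map_eq(1)[OF assms(2,3)]
  using mask_map_eq(2)[OF assms(2,3)] mask_poly_nonzero[OF assms]
  by (auto simp: poly_eq_iff intro!: exI[of _ "coeff (mask_poly \<zeta> S D)"])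

section \<open>The logarithmic derivative\<close>

text \<open>
  The logarithmic derivative for \<open>X d/dX\<close> instead of \<open>d/dX\<close>: it commutes with the rotations of \<open>X\<close>.
  It is treated through its values off the roots, which spares fractions of polynomials.
\<close>

definition log_deriv :: "'a::field poly \<Rightarrow> 'a \<Rightarrow> 'a" where
  "log_deriv P x = x * poly (pderiv P) x / poly P x"

lemma log_deriv_mult:
  assumes "poly P x \<noteq> 0" "poly Q x \<noteq> 0"
  shows "log_deriv (P * Q) x = log_deriv P x + log_deriv Q x"
  using assms by (simp add: log_deriv_def pderiv_mult field_simps)

lemma log_deriv_1 [simp]: "log_deriv 1 x = 0"
  by (simp add: log_deriv_def)

lemma log_deriv_smult: "c \<noteq> 0 \<Longrightarrow> log_deriv (smult c P) x = log_deriv P x"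
  by (simp add: log_deriv_def pderiv_smult)

lemma log_deriv_prod:
  assumes "\<And>i. i \<in> A \<Longrightarrow> poly (f i) x \<noteq> 0"
  shows "log_deriv (prod f A) x = (\<Sum>i\<in>A. log_deriv (f i) x)"
  using assms
  by (induction A rule: infinite_finite_induct) (auto simp: log_deriv_mult poly_prod)

lemma log_deriv_prod_mset:
  assumes "\<And>i. i \<in># A \<Longrightarrow> poly (f i) x \<noteq> 0"
  shows "log_deriv (\<Prod>i\<in>#A. f i) x = (\<Sum>i\<in>#A. log_deriv (f i) x)"
  using assms
proof (induction A)
  case (add a A)
  then have "poly (\<Prod>i\<in>#A. f i) x \<noteq> 0"
    by (auto simp: poly_prod_mset prod_mset_zero_iff)
  then show ?case using add by (simp add: log_deriv_mult)
qed simp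

lemma log_deriv_mask_poly:
  assumes "\<And>M. M \<in> set S \<Longrightarrow> finite M" "poly (mask_poly \<zeta> S D) x \<noteq> 0"
  shows "log_deriv (mask_poly \<zeta> S D) x = (\<Sum>\<nu><length S. \<Sum>p\<in>#D ! \<nu>. \<Sum>a\<in>S ! \<nu>.
    x * point_coord p 1 / (x * point_coord p 1 - \<zeta> ^ a * point_coord p 0))"
proof -
  let ?l = "\<lambda>p a. [: - (\<zeta> ^ a * point_coord p 0), point_coord p 1 :]"
  have fin: "\<nu> < length S \<Longrightarrow> finite (S ! \<nu>)" for \<nu> using assms(1) by simp
  define g where "g \<nu> p = (\<Prod>a\<in>S ! \<nu>. ?l p a)" for \<nu> p
  define h where "h \<nu> = (\<Prod>p\<in>#D ! \<nu>. g \<nu> p)" for \<nu>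
  have P: "mask_poly \<zeta> S D = (\<Prod>\<nu><length S. h \<nu>)"
    by (simp add: mask_poly_def g_def h_def)
  have h: "poly (h \<nu>) x \<noteq> 0" if "\<nu> < length S" for \<nu>
    using assms(2) that by (auto simp: P poly_prod)
  have g: "poly (g \<nu> p) x \<noteq> 0" if "\<nu> < length S" "p \<in># D ! \<nu>" for \<nu> p
    using h[OF that(1)] that by (auto simp: h_def poly_prod_mset prod_mset_zero_iff)
  have l: "poly (?l p a) x \<noteq> 0" if "\<nu> < length S" "p \<in># D ! \<nu>" "a \<in> S ! \<nu>" for \<nu> p a
    using g[OF that(1,2)] that fin unfolding g_def poly_prod by (metis (no_types, lifting) prod_zero_iff)
  have "log_deriv (mask_poly \<zeta> S D) x = (\<Sum>\<nu><length S. log_deriv (h \<nu>) x)"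
    unfolding P using h by (intro log_deriv_prod) auto
  also have "\<dots> = (\<Sum>\<nu><length S. \<Sum>p\<in>#D ! \<nu>. log_deriv (g \<nu> p) x)"
    unfolding h_def using g by (intro sum.cong refl log_deriv_prod_mset) auto
  also have "\<dots> = (\<Sum>\<nu><length S. \<Sum>p\<in>#D ! \<nu>. \<Sum>a\<in>S ! \<nu>. log_deriv (?l p a) x)"
    unfolding g_def using l
    by (intro sum.cong refl arg_cong[where f = sum_mset] image_mset_cong log_deriv_prod) auto
  also have "\<dots> = (\<Sum>\<nu><length S. \<Sum>p\<in>#D ! \<nu>. \<Sum>a\<in>S ! \<nu>.
      x * point_coord p 1 / (x * point_coord p 1 - \<zeta> ^ a * point_coord p 0))"
    by (simp add: log_deriv_def pderiv_pCons)
  finally show ?thesis .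
qed

section \<open>Fourier transform on the cyclic group\<close>

lemma primitive_root_nonzero:
  assumes "primitive_root_of_unity d \<zeta>" "d > 0"
  shows "\<zeta> \<noteq> 0"
  using assms by (auto simp: primitive_root_of_unity_def zero_power)

lemma primitive_root_power_mod:
  assumes "primitive_root_of_unity d \<zeta>"
  shows "\<zeta> ^ (k mod d) = \<zeta> ^ k"
proof -
  have "\<zeta> ^ k = \<zeta> ^ (d * (k div d) + k mod d)" by simp
  also have "\<dots> = \<zeta> ^ (k mod d)"
    using assms unfolding power_add power_mult by (simp add: primitive_root_of_unity_def)
  finally show ?thesis ..
qed

lemma primitive_root_power_inj:
  assumes "primitive_root_of_unity d \<zeta>" "a < d" "k < d" "\<zeta> ^ a = \<zeta> ^ k"
  shows "a = k"
proof -
  have z: "\<zeta> \<noteq> 0" using primitive_root_nonzero assms(1,2) by fastforce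
  have "a' = k'" if "a' \<le> k'" "k' < d" "\<zeta> ^ a' = \<zeta> ^ k'" for a' k'
  proof -
    have "\<zeta> ^ a' * \<zeta> ^ (k' - a') = \<zeta> ^ a' * 1"
      using that by (metis le_add_diff_inverse mult.right_neutral power_add)
    then have "\<zeta> ^ (k' - a') = 1" using z by (metis mult_left_cancel power_not_zero)
    then have "\<not> 0 < k' - a'" using assms(1) that(2) unfolding primitive_root_of_unity_def
      by (metis less_imp_diff_less)
    then show ?thesis using that(1) by simp
  qed
  then show ?thesis using assms(2-) by (metis linear)
qed

text \<open>
  The coefficients are given by the inversion formula; it holds by the orthogonality of characters,
  a geometric sum.
\<close>

lemma fourier_expansion:
  fixes \<zeta> :: "'a::field_char_0"
  assumes "primitive_root_of_unity d \<zeta>"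
  shows "\<exists>g. \<forall>a<d. h a = (\<Sum>j<d. g j * \<zeta> ^ (a * j))"
proof (intro exI allI impI)
  fix a assume a: "a < d"
  then have z: "\<zeta> \<noteq> 0" using primitive_root_nonzero[OF assms] by simp
  have orth: "(\<Sum>j<d. inverse \<zeta> ^ (k * j) * \<zeta> ^ (a * j)) = (if k = a then of_nat d else 0)" if "k < d" for k
  proof -
    define \<eta> where "\<eta> = inverse \<zeta> ^ k * \<zeta> ^ a"
    have "(\<Sum>j<d. inverse \<zeta> ^ (k * j) * \<zeta> ^ (a * j)) = (\<Sum>j<d. \<eta> ^ j)"
      by (simp add: \<eta>_def power_mult_distrib power_mult)
    also have "\<dots> = (if k = a then of_nat d else 0)"
    proof (cases "k = a")
      case True
      then have "\<eta> = 1" using z by (simp add: \<eta>_def flip: power_mult_distrib)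
      then show ?thesis using True by simp
    next
      case False
      have "\<eta> \<noteq> 1"
      proof
        assume "\<eta> = 1"
        then have "\<zeta> ^ a = \<zeta> ^ k" using z by (simp add: \<eta>_def power_inverse field_simps)
        then show False using False primitive_root_power_inj[OF assms a that] by simp
      qed
      moreover have "\<eta> ^ d = (inverse \<zeta> ^ d) ^ k * (\<zeta> ^ d) ^ a"
        by (simp add: \<eta>_def power_mult_distrib flip: power_mult) (simp add: mult.commute)
      then have "\<eta> ^ d = 1" using assms by (simp add: primitive_root_of_unity_def power_inverse)
      ultimately show ?thesis using False geometric_sum[of \<eta> d] by simp
    qed
    finally show ?thesis .
  qed
  have "(\<Sum>j<d. (\<Sum>k<d. h k * inverse \<zeta> ^ (k * j)) / of_nat d * \<zeta> ^ (a * j))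
      = (\<Sum>j<d. \<Sum>k<d. h k / of_nat d * (inverse \<zeta> ^ (k * j) * \<zeta> ^ (a * j)))"
    by (intro sum.cong refl) (simp add: sum_distrib_left sum_divide_distrib mult_ac)
  also have "\<dots> = (\<Sum>k<d. h k / of_nat d * (\<Sum>j<d. inverse \<zeta> ^ (k * j) * \<zeta> ^ (a * j)))"
    by (subst sum.swap) (simp add: sum_distrib_left)
  also have "\<dots> = (\<Sum>k<d. if k = a then h a else 0)"
    using a by (intro sum.cong) (auto simp: orth)
  also have "\<dots> = h a" using a by simp
  finally show "h a = (\<Sum>j<d. (\<Sum>k<d. h k * inverse \<zeta> ^ (k * j)) / of_nat d * \<zeta> ^ (a * j))" ..
qed

text \<open>
  Proportional Fourier coefficients mean convolution: \<open>\<gamma>\<close> is the inverse transform of the factors of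
  proportionality. In frequencies where \<open>S\<close> vanishes the factor is arbitrary. The point is that \<open>\<gamma>\<close>
  depends neither on the mask nor on \<open>h\<close>.
\<close>

lemma mask_sum_transfer:
  fixes \<zeta> :: "'a::field_char_0"
  assumes \<zeta>: "primitive_root_of_unity d \<zeta>" and "d > 0"
    and lines: "\<And>j. j < d \<Longrightarrow> \<exists>c. \<forall>\<nu>\<in>N. mask_lambda \<zeta> (T \<nu>) j = c * mask_lambda \<zeta> (S \<nu>) j"
  shows "\<exists>\<gamma>. \<forall>h::nat \<Rightarrow> 'a. (\<forall>k. h (k mod d) = h k) \<longrightarrow>
    (\<forall>\<nu>\<in>N. (\<Sum>a\<in>T \<nu>. h a) = (\<Sum>b<d. \<gamma> b * (\<Sum>a\<in>S \<nu>. h (a + b))))"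
proof -
  obtain c where c: "\<And>j \<nu>. j < d \<Longrightarrow> \<nu> \<in> N \<Longrightarrow> mask_lambda \<zeta> (T \<nu>) j = c j * mask_lambda \<zeta> (S \<nu>) j"
    using lines by metis
  obtain \<gamma> where \<gamma>: "\<And>j. j < d \<Longrightarrow> c j = (\<Sum>b<d. \<gamma> b * \<zeta> ^ (j * b))"
    using fourier_expansion[OF \<zeta>, of c] by blast
  have main: "(\<Sum>a\<in>T \<nu>. h a) = (\<Sum>b<d. \<gamma> b * (\<Sum>a\<in>S \<nu>. h (a + b)))"
    if h: "\<And>k. h (k mod d) = h k" and \<nu>: "\<nu> \<in> N" for h \<nu>
  proof -
    obtain g where "\<And>a. a < d \<Longrightarrow> h a = (\<Sum>j<d. g j * \<zeta> ^ (a * j))"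
      using fourier_expansion[OF \<zeta>, of h] by blast
    then have g: "h a = (\<Sum>j<d. g j * \<zeta> ^ (a * j))" for a
      using h[of a] assms(2) primitive_root_power_mod[OF \<zeta>] by (metis (no_types, lifting) mod_less_divisor power_mult sum.cong)
    have "(\<Sum>a\<in>T \<nu>. h a) = (\<Sum>j<d. g j * mask_lambda \<zeta> (T \<nu>) j)"
      unfolding g mask_lambda_def sum_distrib_left by (rule sum.swap)
    also have "\<dots> = (\<Sum>j<d. g j * ((\<Sum>b<d. \<gamma> b * \<zeta> ^ (j * b)) * mask_lambda \<zeta> (S \<nu>) j))"
      using c[OF _ \<nu>] \<gamma> by (intro sum.cong) auto
    also have "\<dots> = (\<Sum>j<d. \<Sum>b<d. \<Sum>a\<in>S \<nu>. \<gamma> b * (g j * \<zeta> ^ ((a + b) * j)))"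
      unfolding mask_lambda_def sum_product unfolding sum_distrib_left
      by (intro sum.cong refl) (simp add: algebra_simps power_add)
    also have "\<dots> = (\<Sum>b<d. \<Sum>a\<in>S \<nu>. \<Sum>j<d. \<gamma> b * (g j * \<zeta> ^ ((a + b) * j)))"
      by (subst sum.swap) (intro sum.cong refl sum.swap)
    also have "\<dots> = (\<Sum>b<d. \<gamma> b * (\<Sum>a\<in>S \<nu>. h (a + b)))"
      unfolding g sum_distrib_left ..
    finally show ?thesis .
  qed
  show ?thesis by (intro exI[of _ \<gamma>] allI impI ballI, rule main) auto
qed

section \<open>The differential equation\<close>

definition rotate_poly :: "'a::field \<Rightarrow> nat \<Rightarrow> 'a poly \<Rightarrow> 'a poly" where
  "rotate_poly \<zeta> b P = pcompose P [:0, inverse \<zeta> ^ b:]"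

definition euler_op :: "'a::field poly \<Rightarrow> 'a poly" where
  "euler_op P = pCons 0 (pderiv P)"

definition ode_den :: "'a::field \<Rightarrow> nat \<Rightarrow> 'a poly \<Rightarrow> 'a poly" where
  "ode_den \<zeta> d P = (\<Prod>b<d. rotate_poly \<zeta> b P)"

text \<open>
  The numerator of \<open>\<Sum>b. \<gamma>\<^sub>b (X P'/P)(\<zeta>^(-b) X)\<close> over the common denominator \<^const>\<open>ode_den\<close>.
\<close>

definition ode_num :: "'a::field \<Rightarrow> nat \<Rightarrow> (nat \<Rightarrow> 'a) \<Rightarrow> 'a poly \<Rightarrow> 'a poly" where
  "ode_num \<zeta> d \<gamma> P =
     (\<Sum>b<d. smult (\<gamma> b) (rotate_poly \<zeta> b (euler_op P) * (\<Prod>b'\<in>{..<d} - {b}. rotate_poly \<zeta> b' P)))"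

lemma poly_rotate_poly: "poly (rotate_poly \<zeta> b P) x = poly P (x * inverse \<zeta> ^ b)"
  by (simp add: rotate_poly_def poly_pcompose)

lemma poly_euler_op: "poly (euler_op P) x = x * poly (pderiv P) x"
  by (simp add: euler_op_def)

lemma rotate_poly_nonzero: "\<zeta> \<noteq> 0 \<Longrightarrow> P \<noteq> 0 \<Longrightarrow> rotate_poly \<zeta> b P \<noteq> 0"
  unfolding rotate_poly_def by (subst pcompose_eq_0_iff) auto

lemma ode_den_nonzero: "\<zeta> \<noteq> 0 \<Longrightarrow> P \<noteq> 0 \<Longrightarrow> ode_den \<zeta> d P \<noteq> 0"
  by (simp add: ode_den_def rotate_poly_nonzero)

lemma ode_num_eq_log_deriv:
  assumes "poly (ode_den \<zeta> d P) x \<noteq> 0"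
  shows "poly (ode_num \<zeta> d \<gamma> P) x
    = poly (ode_den \<zeta> d P) x * (\<Sum>b<d. \<gamma> b * log_deriv P (x * inverse \<zeta> ^ b))"
proof -
  have nz: "poly P (x * inverse \<zeta> ^ b) \<noteq> 0" if "b < d" for b
    using assms that by (auto simp: ode_den_def poly_prod poly_rotate_poly)
  have "poly (rotate_poly \<zeta> b (euler_op P) * (\<Prod>b'\<in>{..<d} - {b}. rotate_poly \<zeta> b' P)) x
      = poly (ode_den \<zeta> d P) x * log_deriv P (x * inverse \<zeta> ^ b)" if "b < d" for b
  proof -
    have "ode_den \<zeta> d P = rotate_poly \<zeta> b P * (\<Prod>b'\<in>{..<d} - {b}. rotate_poly \<zeta> b' P)"
      unfolding ode_den_def using that by (intro prod.remove) auto
    then show ?thesis using nz[OF that]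
      by (simp add: poly_rotate_poly poly_euler_op log_deriv_def)
  qed
  then show ?thesis
    by (simp add: ode_num_def poly_sum sum_distrib_left mult_ac)
qed

lemma poly_eq_off_roots:
  fixes A B R :: "'a::{idom,ring_char_0} poly"
  assumes "R \<noteq> 0" "\<And>x. poly R x \<noteq> 0 \<Longrightarrow> poly A x = poly B x"
  shows "A = B"
proof -
  have "\<forall>x. poly (R * (A - B)) x = 0" using assms(2) by auto
  then have "R * (A - B) = 0" by (simp only: poly_all_0_iff_0)
  then show ?thesis using assms(1) by simp
qed

lemma ode_of_log_deriv:
  fixes P Q :: "'a::field_char_0 poly"
  assumes "\<zeta> \<noteq> 0" "P \<noteq> 0" "Q \<noteq> 0"
    and "\<And>x. poly Q x \<noteq> 0 \<Longrightarrow> (\<And>b. b < d \<Longrightarrow> poly P (x * inverse \<zeta> ^ b) \<noteq> 0) \<Longrightarrow>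
      log_deriv Q x = (\<Sum>b<d. \<gamma> b * log_deriv P (x * inverse \<zeta> ^ b))"
  shows "euler_op Q * ode_den \<zeta> d P = Q * ode_num \<zeta> d \<gamma> P"
proof (rule poly_eq_off_roots)
  show "Q * ode_den \<zeta> d P \<noteq> 0" using assms ode_den_nonzero by auto
  fix x assume x: "poly (Q * ode_den \<zeta> d P) x \<noteq> 0"
  then have "log_deriv Q x = (\<Sum>b<d. \<gamma> b * log_deriv P (x * inverse \<zeta> ^ b))"
    by (intro assms(4)) (auto simp: ode_den_def poly_prod poly_rotate_poly)
  moreover have "poly (euler_op Q) x = poly Q x * log_deriv Q x"
    using x by (simp add: poly_euler_op log_deriv_def)
  ultimately show "poly (euler_op Q * ode_den \<zeta> d P) x = poly (Q * ode_num \<zeta> d \<gamma> P) x"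
    using x by (simp add: ode_num_eq_log_deriv)
qed

text \<open>
  The Wronskian condition forces equal degrees, by comparison of leading coefficients in
  characteristic zero. After subtraction of the multiple of \<open>Q\<close> that kills the leading term of \<open>P\<close>,
  the difference satisfies the same condition with a smaller degree, hence vanishes.
\<close>

lemma wronskian_proportional:
  fixes P Q :: "'a::field_char_0 poly"
  assumes "Q \<noteq> 0" "pderiv P * Q = P * pderiv Q"
  shows "\<exists>c. P = smult c Q"
proof -
  have deg: "degree H = degree Q" if "H \<noteq> 0" "pderiv H * Q = H * pderiv Q" for H
  proof (cases "degree H = 0 \<or> degree Q = 0")
    case True
    moreover have "degree H = 0 \<longleftrightarrow> degree Q = 0"
      unfolding pderiv_eq_0_iff[symmetric] using that assms(1) by (metis mult_eq_0_iff)
    ultimately show ?thesis by simp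
  next
    case False
    have "lead_coeff (pderiv H * Q) = lead_coeff (H * pderiv Q)" using that(2) by simp
    then have "of_nat (degree H) * lead_coeff H * lead_coeff Q
        = lead_coeff H * (of_nat (degree Q) * lead_coeff Q)"
      using False by (simp only: lead_coeff_mult degree_pderiv coeff_pderiv) simp
    then show ?thesis using that assms(1) by simp
  qed
  show ?thesis
  proof (cases "P = 0")
    case True
    then show ?thesis by (intro exI[of _ 0]) simp
  next
    case False
    then have dP: "degree P = degree Q" using deg assms(2) by blast
    define c where "c = lead_coeff P / lead_coeff Q"
    define H where "H = P - smult c Q"
    have "pderiv H * Q = H * pderiv Q"
      using assms(2) by (simp add: H_def pderiv_diff pderiv_smult algebra_simps)
    moreover have "H = 0 \<or> degree H \<noteq> degree Q"
    proof (rule ccontr)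
      assume H: "\<not> (H = 0 \<or> degree H \<noteq> degree Q)"
      have "coeff H (degree Q) = 0" using assms(1) dP by (simp add: H_def c_def)
      then show False using H by (metis leading_coeff_0_iff)
    qed
    ultimately have "H = 0" using deg by blast
    then show ?thesis by (auto simp: H_def)
  qed
qed

text \<open>
  Two solutions have the same logarithmic derivative, so their Wronskian vanishes.
\<close>

lemma ode_solution_unique:
  fixes P Q :: "'a::field_char_0 poly"
  assumes "\<zeta> \<noteq> 0" "P \<noteq> 0" "Q \<noteq> 0"
    and "euler_op Q * ode_den \<zeta> d P = Q * ode_num \<zeta> d \<gamma> P"
    and "euler_op E * ode_den \<zeta> d P = E * ode_num \<zeta> d \<gamma> P"
  shows "\<exists>c. E = smult c Q"
proof (rule wronskian_proportional[OF assms(3)])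
  have "(euler_op E * Q) * ode_den \<zeta> d P = (E * euler_op Q) * ode_den \<zeta> d P"
    using assms(4,5) by (metis mult.assoc mult.commute)
  then have "euler_op E * Q = E * euler_op Q"
    using ode_den_nonzero[OF assms(1,2)] by (metis mult_right_cancel)
  then show "pderiv E * Q = E * pderiv Q" by (simp add: euler_op_def)
qed

text \<open>
  The differential equation relating the two forms of a point. The same \<open>\<gamma>\<close> serves all \<open>D\<close>, so the
  equation depends on \<open>D\<close> only through the form for \<open>S\<close>. The scalar \<open>c\<close> accounts for the choice of
  homogeneous coordinates.
\<close>

lemma ode_mask_poly:
  fixes \<zeta> :: "'a::field_char_0"
  assumes \<zeta>: "primitive_root_of_unity d \<zeta>" and "d > 0"
    and len: "length S = length n" "length T = length n"
    and S: "\<And>M. M \<in> set S \<Longrightarrow> finite M" and T: "\<And>M. M \<in> set T \<Longrightarrow> finite M"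
    and lines: "\<And>j. j < d \<Longrightarrow>
      \<exists>c. \<forall>\<nu><length n. mask_lambda \<zeta> (T ! \<nu>) j = c * mask_lambda \<zeta> (S ! \<nu>) j"
  shows "\<exists>\<gamma>. \<forall>D\<in>sym_product n. \<forall>c. c \<noteq> 0 \<longrightarrow>
    euler_op (mask_poly \<zeta> T D) * ode_den \<zeta> d (smult c (mask_poly \<zeta> S D))
      = mask_poly \<zeta> T D * ode_num \<zeta> d \<gamma> (smult c (mask_poly \<zeta> S D))"
proof -
  have z: "\<zeta> \<noteq> 0" using primitive_root_nonzero[OF \<zeta> assms(2)] .
  have "\<exists>\<gamma>. \<forall>h::nat \<Rightarrow> 'a. (\<forall>k. h (k mod d) = h k) \<longrightarrow> (\<forall>\<nu>\<in>{..<length n}.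
      (\<Sum>a\<in>T ! \<nu>. h a) = (\<Sum>b<d. \<gamma> b * (\<Sum>a\<in>S ! \<nu>. h (a + b))))"
  proof (rule mask_sum_transfer[OF \<zeta> assms(2)])
    show "\<exists>c. \<forall>\<nu>\<in>{..<length n}. mask_lambda \<zeta> (T ! \<nu>) j = c * mask_lambda \<zeta> (S ! \<nu>) j"
      if "j < d" for j
      using lines[OF that] by (simp add: Ball_def)
  qed
  then obtain \<gamma> where \<gamma>: "\<forall>h::nat \<Rightarrow> 'a. (\<forall>k. h (k mod d) = h k) \<longrightarrow> (\<forall>\<nu>\<in>{..<length n}.
      (\<Sum>a\<in>T ! \<nu>. h a) = (\<Sum>b<d. \<gamma> b * (\<Sum>a\<in>S ! \<nu>. h (a + b))))" ..
  have "euler_op (mask_poly \<zeta> T D) * ode_den \<zeta> d (smult c (mask_poly \<zeta> S D))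
      = mask_poly \<zeta> T D * ode_num \<zeta> d \<gamma> (smult c (mask_poly \<zeta> S D))"
    if D: "D \<in> sym_product n" and c: "c \<noteq> 0" for D c
  proof (rule ode_of_log_deriv[OF z])
    fix x
    assume xT: "poly (mask_poly \<zeta> T D) x \<noteq> 0"
      and xS: "\<And>b. b < d \<Longrightarrow> poly (smult c (mask_poly \<zeta> S D)) (x * inverse \<zeta> ^ b) \<noteq> 0"
    define h where "h p k = x * point_coord p 1 / (x * point_coord p 1 - \<zeta> ^ k * point_coord p 0)" for p k
    \<comment> \<open>Rotation of \<open>x\<close> translates \<open>h\<close>.\<close>
    have rot: "log_deriv (smult c (mask_poly \<zeta> S D)) (x * inverse \<zeta> ^ b)
        = (\<Sum>\<nu><length n. \<Sum>p\<in>#D ! \<nu>. \<Sum>a\<in>S ! \<nu>. h p (a + b))" if b: "b < d" for b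
    proof -
      let ?y = "x * inverse \<zeta> ^ b"
      have "?y * v / (?y * v - \<zeta> ^ a * u) = x * v / (x * v - \<zeta> ^ (a + b) * u)" for a and u v :: 'a
      proof -
        have 1: "\<zeta> ^ b * (?y * v) = x * v"
          using z by (simp add: power_inverse)
        have 2: "\<zeta> ^ b * (?y * v - \<zeta> ^ a * u) = x * v - \<zeta> ^ (a + b) * u"
          unfolding right_diff_distrib 1 by (simp add: power_add mult_ac)
        have "?y * v / (?y * v - \<zeta> ^ a * u)
            = (\<zeta> ^ b * (?y * v)) / (\<zeta> ^ b * (?y * v - \<zeta> ^ a * u))"
          using z by (intro mult_divide_mult_cancel_left[symmetric]) simp
        then show ?thesis unfolding 1 2 .
      qed
      note rotated = this
      have nz: "poly (mask_poly \<zeta> S D) ?y \<noteq> 0" using xS[OF b] by simp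
      show ?thesis
        unfolding log_deriv_smult[OF c] h_def rotated[symmetric] len(1)[symmetric]
        by (rule log_deriv_mask_poly[OF S nz])
    qed
    have "log_deriv (mask_poly \<zeta> T D) x = (\<Sum>\<nu><length n. \<Sum>p\<in>#D ! \<nu>. \<Sum>a\<in>T ! \<nu>. h p a)"
      unfolding h_def len(2)[symmetric] by (rule log_deriv_mask_poly[OF T xT])
    also have "\<dots> = (\<Sum>\<nu><length n. \<Sum>p\<in>#D ! \<nu>. \<Sum>b<d. \<gamma> b * (\<Sum>a\<in>S ! \<nu>. h p (a + b)))"
    proof (rule sum.cong[OF refl])
      fix \<nu> assume \<nu>: "\<nu> \<in> {..<length n}"
      have "h p (k mod d) = h p k" for p k
        by (simp add: h_def primitive_root_power_mod[OF \<zeta>])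
      then have "(\<Sum>a\<in>T ! \<nu>. h p a) = (\<Sum>b<d. \<gamma> b * (\<Sum>a\<in>S ! \<nu>. h p (a + b)))" for p
        using \<gamma>[rule_format, of "h p" \<nu>] \<nu> by blast
      then show "(\<Sum>p\<in>#D ! \<nu>. \<Sum>a\<in>T ! \<nu>. h p a)
          = (\<Sum>p\<in>#D ! \<nu>. \<Sum>b<d. \<gamma> b * (\<Sum>a\<in>S ! \<nu>. h p (a + b)))" by simp
    qed
    also have "\<dots> = (\<Sum>b<d. \<gamma> b * (\<Sum>\<nu><length n. \<Sum>p\<in>#D ! \<nu>. \<Sum>a\<in>S ! \<nu>. h p (a + b)))"
    proof -
      have swap: "(\<Sum>p\<in>#A. \<Sum>b<d. \<gamma> b * u p b) = (\<Sum>b<d. \<gamma> b * (\<Sum>p\<in>#A. u p b))" for A and u :: "'a ppoint \<Rightarrow> nat \<Rightarrow> 'a"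
        by (induction A) (simp_all add: sum.distrib distrib_left)
      show ?thesis
        unfolding swap
        by (subst sum.swap) (intro sum.cong refl sum_distrib_left[symmetric])
    qed
    also have "\<dots> = (\<Sum>b<d. \<gamma> b * log_deriv (smult c (mask_poly \<zeta> S D)) (x * inverse \<zeta> ^ b))"
      by (simp add: rot)
    finally show "log_deriv (mask_poly \<zeta> T D) x
      = (\<Sum>b<d. \<gamma> b * log_deriv (smult c (mask_poly \<zeta> S D)) (x * inverse \<zeta> ^ b))" .
  qed (use mask_poly_nonzero[OF z D] len c in auto)
  then show ?thesis by blast
qed

section \<open>Regularity of the induced map\<close>

definition poly_of_coords :: "nat \<Rightarrow> (nat \<Rightarrow> 'a::comm_ring_1) \<Rightarrow> 'a poly" where
  "poly_of_coords m x = (\<Sum>i\<le>m. monom (x i) i)"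

lemma coeff_poly_of_coords: "coeff (poly_of_coords m x) k = (if k \<le> m then x k else 0)"
  by (simp add: poly_of_coords_def coeff_sum coeff_monom sum.delta)

definition form_poly :: "nat \<Rightarrow> nat \<Rightarrow> ((nat \<Rightarrow> 'a::field) \<Rightarrow> 'a poly) \<Rightarrow> bool" where
  "form_poly m r P \<longleftrightarrow> (\<forall>l. (\<lambda>x. coeff (P x) l) \<in> form_functions m r)"

lemma form_poly_const: "form_poly m 0 (\<lambda>x. P)"
  by (simp add: form_poly_def form_function_const)

lemma form_poly_mult:
  assumes "form_poly m r P" "form_poly m s Q"
  shows "form_poly m (r + s) (\<lambda>x. P x * Q x)"
  using assms unfolding form_poly_def coeff_mult
  by (auto intro!: form_function_sum form_function_mult)

lemma form_poly_sum:
  assumes "\<And>i. i \<in> A \<Longrightarrow> form_poly m r (P i)"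
  shows "form_poly m r (\<lambda>x. \<Sum>i\<in>A. P i x)"
  using assms unfolding form_poly_def coeff_sum by (auto intro!: form_function_sum)

lemma form_poly_diff:
  assumes "form_poly m r P" "form_poly m r Q"
  shows "form_poly m r (\<lambda>x. P x - Q x)"
  using assms unfolding form_poly_def by (auto intro!: form_function_diff)

lemma form_poly_smult: "form_poly m r P \<Longrightarrow> form_poly m r (\<lambda>x. smult c (P x))"
  unfolding form_poly_def by (auto intro!: form_function_scale)

lemma form_poly_prod:
  assumes "finite A" "\<And>i. i \<in> A \<Longrightarrow> form_poly m 1 (P i)"
  shows "form_poly m (card A) (\<lambda>x. \<Prod>i\<in>A. P i x)"
  using assms
proof (induction A rule: finite_induct)
  case empty
  then show ?case using form_poly_const[of m 1] by simp
next
  case (insert i A)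
  then show ?case using form_poly_mult[of m 1 "P i" "card A" "\<lambda>x. \<Prod>i\<in>A. P i x"] by simp
qed

lemma form_poly_rotate_poly: "form_poly m r P \<Longrightarrow> form_poly m r (\<lambda>x. rotate_poly \<zeta> b (P x))"
  unfolding form_poly_def rotate_poly_def coeff_pcompose_linear
  by (auto intro!: form_function_scale)

lemma coeff_euler_op: "coeff (euler_op P) k = of_nat k * coeff P k"
  by (cases k) (simp_all add: euler_op_def coeff_pderiv)

lemma form_poly_euler_op: "form_poly m r P \<Longrightarrow> form_poly m r (\<lambda>x. euler_op (P x))"
  unfolding form_poly_def coeff_euler_op by (auto intro!: form_function_scale)

lemma form_poly_poly_of_coords: "form_poly m 1 (poly_of_coords m)"
  unfolding form_poly_def coeff_poly_of_coords
proof
  show "(\<lambda>x. if l \<le> m then x l else 0) \<in> form_functions m 1" for l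
    by (cases "l \<le> m") (simp_all add: form_function_var[unfolded One_nat_def])
qed

definition ode_operator :: "'a::field \<Rightarrow> nat \<Rightarrow> (nat \<Rightarrow> 'a) \<Rightarrow> 'a poly \<Rightarrow> 'a poly \<Rightarrow> 'a poly" where
  "ode_operator \<zeta> d \<gamma> P Q = euler_op Q * ode_den \<zeta> d P - Q * ode_num \<zeta> d \<gamma> P"

text \<open>
  The product of the \<open>d\<close> rotated copies of \<open>P\<close> has degree \<open>d\<close> in the coefficients of \<open>P\<close>. In the
  numerator, differentiation of one factor does not change the degree.
\<close>

lemma form_poly_ode_operator:
  assumes "d > 0"
  shows "form_poly m d (\<lambda>x. ode_operator \<zeta> d \<gamma> (poly_of_coords m x) Q)"
proof -
  note basic = form_poly_rotate_poly form_poly_euler_op form_poly_poly_of_coords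
  have den: "form_poly m d (\<lambda>x. ode_den \<zeta> d (poly_of_coords m x))"
  proof -
    have "form_poly m (card {..<d}) (\<lambda>x. \<Prod>b<d. rotate_poly \<zeta> b (poly_of_coords m x))"
      by (intro form_poly_prod basic) auto
    then show ?thesis by (simp add: ode_den_def)
  qed
  have "form_poly m d (\<lambda>x. rotate_poly \<zeta> b (euler_op (poly_of_coords m x)) *
      (\<Prod>b'\<in>{..<d} - {b}. rotate_poly \<zeta> b' (poly_of_coords m x)))" if "b < d" for b
  proof -
    have "form_poly m (card ({..<d} - {b})) (\<lambda>x. \<Prod>b'\<in>{..<d} - {b}. rotate_poly \<zeta> b' (poly_of_coords m x))"
      by (intro form_poly_prod basic) auto
    then have "form_poly m (1 + card ({..<d} - {b})) (\<lambda>x. rotate_poly \<zeta> b (euler_op (poly_of_coords m x)) *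
      (\<Prod>b'\<in>{..<d} - {b}. rotate_poly \<zeta> b' (poly_of_coords m x)))"
      by (intro form_poly_mult basic)
    then show ?thesis using that by simp
  qed
  then have "form_poly m d (\<lambda>x. ode_num \<zeta> d \<gamma> (poly_of_coords m x))"
    unfolding ode_num_def by (intro form_poly_sum form_poly_smult) auto
  then have "form_poly m (0 + d) (\<lambda>x. Q * ode_num \<zeta> d \<gamma> (poly_of_coords m x))"
    by (intro form_poly_mult form_poly_const)
  moreover have "form_poly m (0 + d) (\<lambda>x. euler_op Q * ode_den \<zeta> d (poly_of_coords m x))"
    by (intro form_poly_mult form_poly_const den)
  ultimately show ?thesis
    unfolding ode_operator_def by (simp add: form_poly_diff)
qed

lemma coeff_ode_operator:
  "coeff (ode_operator \<zeta> d \<gamma> P (poly_of_coords k e)) l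
    = (\<Sum>i\<le>k. coeff (ode_operator \<zeta> d \<gamma> P (monom 1 i)) l * e i)"
proof -
  have "euler_op (Q + R) = euler_op Q + euler_op R" for Q R :: "'a poly"
    by (rule poly_eqI) (simp add: coeff_euler_op distrib_left)
  then have add: "ode_operator \<zeta> d \<gamma> P (Q + R) = ode_operator \<zeta> d \<gamma> P Q + ode_operator \<zeta> d \<gamma> P R" for Q R
    by (simp add: ode_operator_def algebra_simps)
  have zero: "ode_operator \<zeta> d \<gamma> P 0 = 0"
    by (simp add: ode_operator_def euler_op_def)
  have sum: "ode_operator \<zeta> d \<gamma> P (\<Sum>i\<in>I. Q i) = (\<Sum>i\<in>I. ode_operator \<zeta> d \<gamma> P (Q i))"
    for I and Q :: "nat \<Rightarrow> 'a poly"
    by (induction I rule: infinite_finite_induct) (simp_all add: add zero)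
  have monom: "ode_operator \<zeta> d \<gamma> P (monom c i) = smult c (ode_operator \<zeta> d \<gamma> P (monom 1 i))" for c i
  proof -
    have m: "monom c i = smult c (monom 1 i)" by (simp add: smult_monom)
    have "euler_op (smult c (monom 1 i)) = smult c (euler_op (monom 1 i))"
      by (rule poly_eqI) (simp add: coeff_euler_op)
    then show ?thesis unfolding m by (simp add: ode_operator_def smult_diff_right)
  qed
  show ?thesis
    unfolding poly_of_coords_def sum coeff_sum
    by (intro sum.cong refl) (subst monom, simp add: mult.commute)
qed

text \<open>
  Near a given point the coefficients of the form for \<open>T\<close> are, up to a common factor, the forms that
  elimination extracts from the differential equation. The equation has a one-dimensional solution
  space at every point of the image, so that no point needs special treatment.
\<close>

lemma regular_map_if_lambda_proportional:
  fixes \<zeta> :: "'a::field_char_0"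
  assumes \<zeta>: "primitive_root_of_unity d \<zeta>" and "d > 0"
    and len: "length S = length n" "length T = length n"
    and fin: "\<And>M. M \<in> set S \<Longrightarrow> finite M" "\<And>M. M \<in> set T \<Longrightarrow> finite M"
    and lines: "\<And>j. j < d \<Longrightarrow>
      \<exists>c. \<forall>\<nu><length n. mask_lambda \<zeta> (T ! \<nu>) j = c * mask_lambda \<zeta> (S ! \<nu>) j"
    and \<phi>: "\<And>D. D \<in> sym_product n \<Longrightarrow> \<phi> (mask_map \<zeta> n S D) = mask_map \<zeta> n T D"
  shows "regular_map (form_degree n S) (form_degree n T) (mask_variety \<zeta> n S) (mask_variety \<zeta> n T) \<phi>"
  unfolding regular_map_def
proof (intro conjI ballI)
  show "\<phi> \<in> mask_variety \<zeta> n S \<rightarrow> mask_variety \<zeta> n T"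
    using \<phi> by (auto simp: mask_variety_def)
next
  fix p assume "p \<in> mask_variety \<zeta> n S"
  then obtain D\<^sub>0 where D0: "D\<^sub>0 \<in> sym_product n" and p: "p = mask_map \<zeta> n S D\<^sub>0"
    by (auto simp: mask_variety_def)
  let ?m = "form_degree n S" and ?k = "form_degree n T"
  have z: "\<zeta> \<noteq> 0" using primitive_root_nonzero[OF \<zeta> assms(2)] .
  obtain \<gamma> where ode: "\<And>D c. D \<in> sym_product n \<Longrightarrow> c \<noteq> 0 \<Longrightarrow>
      euler_op (mask_poly \<zeta> T D) * ode_den \<zeta> d (smult c (mask_poly \<zeta> S D))
        = mask_poly \<zeta> T D * ode_num \<zeta> d \<gamma> (smult c (mask_poly \<zeta> S D))"
    using ode_mask_poly[OF \<zeta> assms(2) len fin lines] by blast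
  define A where "A l i x = coeff (ode_operator \<zeta> d \<gamma> (poly_of_coords ?m x) (monom 1 i)) l" for l i x
  have A: "(\<Sum>i\<le>?k. A l i x * e i) = coeff (ode_operator \<zeta> d \<gamma> (poly_of_coords ?m x) (poly_of_coords ?k e)) l"
    for l x e by (simp add: A_def coeff_ode_operator)
  have coordsS: "poly_of_coords ?m (\<lambda>i. c * coeff (mask_poly \<zeta> S D) i) = smult c (mask_poly \<zeta> S D)"
    if "D \<in> sym_product n" for D c
    using mask_map_eq(2)[OF that len(1)] by (intro poly_eqI) (auto simp: coeff_poly_of_coords)
  have coordsT: "poly_of_coords ?k (coeff (mask_poly \<zeta> T D)) = mask_poly \<zeta> T D"
    if "D \<in> sym_product n" for D
    using mask_map_eq(2)[OF that len(2)] by (intro poly_eqI) (auto simp: coeff_poly_of_coords)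
  let ?x0 = "coeff (mask_poly \<zeta> S D\<^sub>0)"
  have "\<exists>q s g G. g \<in> form_functions ?m q \<and> g ?x0 \<noteq> 0 \<and> (\<forall>i\<in>{..?k}. G i \<in> form_functions ?m s) \<and>
    (\<forall>x e. g x \<noteq> 0 \<longrightarrow> (\<forall>l. (\<Sum>i\<le>?k. A l i x * e i) = 0) \<longrightarrow> (\<exists>c. \<forall>i\<in>{..?k}. e i = c * G i x))"
  proof (rule form_elimination)
    show "A l i \<in> form_functions ?m d" for l i
      using form_poly_ode_operator[OF assms(2), of ?m \<zeta> \<gamma> "monom 1 i"] by (simp add: form_poly_def A_def[abs_def])
    fix e assume "\<forall>l. (\<Sum>i\<le>?k. A l i ?x0 * e i) = 0"
    then have "ode_operator \<zeta> d \<gamma> (poly_of_coords ?m ?x0) (poly_of_coords ?k e) = 0"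
      unfolding A by (intro poly_eqI) simp
    moreover have "poly_of_coords ?m ?x0 = mask_poly \<zeta> S D\<^sub>0" using coordsS[OF D0, of 1] by simp
    ultimately have "euler_op (poly_of_coords ?k e) * ode_den \<zeta> d (mask_poly \<zeta> S D\<^sub>0)
        = poly_of_coords ?k e * ode_num \<zeta> d \<gamma> (mask_poly \<zeta> S D\<^sub>0)"
      by (simp add: ode_operator_def)
    moreover have "euler_op (mask_poly \<zeta> T D\<^sub>0) * ode_den \<zeta> d (mask_poly \<zeta> S D\<^sub>0)
        = mask_poly \<zeta> T D\<^sub>0 * ode_num \<zeta> d \<gamma> (mask_poly \<zeta> S D\<^sub>0)"
      using ode[OF D0, of 1] by simp
    ultimately obtain c where c: "poly_of_coords ?k e = smult c (mask_poly \<zeta> T D\<^sub>0)"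
      using ode_solution_unique[OF z] mask_poly_nonzero[OF z D0] len by metis
    have "e i = c * coeff (mask_poly \<zeta> T D\<^sub>0) i" if "i \<le> ?k" for i
      using arg_cong[OF c, of "\<lambda>P. coeff P i"] that by (simp add: coeff_poly_of_coords)
    then show "\<exists>c. \<forall>i\<in>{..?k}. e i = c * coeff (mask_poly \<zeta> T D\<^sub>0) i" by auto
  qed auto
  then obtain q s g G where g: "g \<in> form_functions ?m q" "g ?x0 \<noteq> 0"
    and G: "\<forall>i\<in>{..?k}. G i \<in> form_functions ?m s"
    and sol: "\<forall>x e. g x \<noteq> 0 \<longrightarrow> (\<forall>l. (\<Sum>i\<le>?k. A l i x * e i) = 0) \<longrightarrow> (\<exists>c. \<forall>i\<in>{..?k}. e i = c * G i x)"
    by blast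
  obtain g' where g': "g' \<in> homogeneous_polys ?m q" "g = mpoly_eval g'"
    using g(1) by (auto simp: form_functions_def)
  have "\<exists>F. i \<le> ?k \<longrightarrow> F \<in> homogeneous_polys ?m s \<and> G i = mpoly_eval F" for i
    using G by (auto simp: form_functions_def)
  then obtain F where F: "\<And>i. i \<le> ?k \<Longrightarrow> F i \<in> homogeneous_polys ?m s"
    "\<And>i. i \<le> ?k \<Longrightarrow> G i = mpoly_eval (F i)" by metis
  define U where "U = {p \<in> proj_space ?m. \<exists>G\<in>{g'}. \<forall>x\<in>p. mpoly_eval G x \<noteq> 0}"
  have U: "zariski_open ?m U"
    unfolding zariski_open_def U_def using g'(1) by (intro exI[of _ "{g'}"]) auto
  have "p \<in> U"
    unfolding U_def p using mask_map_in_proj_space[OF z D0 len(1)]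
    using form_function_homogeneous[OF g(1)] g(2) g'(2)
    by (auto simp: mask_map_eq(1)[OF D0 len(1)] proj_class_def)
  moreover have "(\<exists>i\<le>?k. mpoly_eval (F i) x \<noteq> 0) \<and>
      \<phi> q = proj_class (\<lambda>i. if i \<le> ?k then mpoly_eval (F i) x else 0)"
    if q: "q \<in> mask_variety \<zeta> n S \<inter> U" and x: "x \<in> q" for q x
  proof -
    obtain D where D: "D \<in> sym_product n" "q = mask_map \<zeta> n S D"
      using q by (auto simp: mask_variety_def)
    obtain c where c: "c \<noteq> 0" "x = (\<lambda>i. c * coeff (mask_poly \<zeta> S D) i)"
      using x mem_proj_classD unfolding D(2) mask_map_eq(1)[OF D(1) len(1)] by blast
    have "g x \<noteq> 0" using q x by (simp add: U_def g'(2))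
    moreover have "(\<Sum>i\<le>?k. A l i x * coeff (mask_poly \<zeta> T D) i) = 0" for l
      unfolding A c(2) coordsS[OF D(1)] coordsT[OF D(1)] using ode[OF D(1) c(1)]
      by (simp add: ode_operator_def)
    ultimately obtain b where b: "\<And>i. i \<le> ?k \<Longrightarrow> coeff (mask_poly \<zeta> T D) i = b * G i x"
      using sol[rule_format, of x "coeff (mask_poly \<zeta> T D)"] by auto
    have eq: "coeff (mask_poly \<zeta> T D) = (\<lambda>i. b * (if i \<le> ?k then mpoly_eval (F i) x else 0))"
      using b F(2) mask_map_eq(2)[OF D(1) len(2)] by (intro ext) auto
    have "mask_poly \<zeta> T D \<noteq> 0" by (rule mask_poly_nonzero[OF z D(1) len(2)])
    then have "\<exists>i. coeff (mask_poly \<zeta> T D) i \<noteq> 0" by (auto simp: poly_eq_iff)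
    then have "b \<noteq> 0" "\<exists>i\<le>?k. mpoly_eval (F i) x \<noteq> 0"
      unfolding eq by (auto split: if_splits)
    then show ?thesis
      using \<phi>[OF D(1)] eq by (auto simp: D(2) mask_map_eq(1)[OF D(1) len(2)] proj_class_eq_iff)
  qed
  ultimately show "\<exists>U r F. zariski_open ?m U \<and> p \<in> U \<and> (\<forall>i\<le>?k. F i \<in> homogeneous_polys ?m r) \<and>
      (\<forall>q\<in>mask_variety \<zeta> n S \<inter> U. \<forall>x\<in>q. (\<exists>i\<le>?k. mpoly_eval (F i) x \<noteq> 0) \<and>
        \<phi> q = proj_class (\<lambda>i. if i \<le> ?k then mpoly_eval (F i) x else 0))"
    using U F(1) by blast
qed

text \<open>
  The differential equation sees only the form for \<open>S\<close>, and its nonzero solutions are proportional.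
\<close>

lemma mask_map_determines:
  fixes \<zeta> :: "'a::field_char_0"
  assumes \<zeta>: "primitive_root_of_unity d \<zeta>" and "d > 0"
    and len: "length S = length n" "length T = length n"
    and fin: "\<And>M. M \<in> set S \<Longrightarrow> finite M" "\<And>M. M \<in> set T \<Longrightarrow> finite M"
    and lines: "\<And>j. j < d \<Longrightarrow>
      \<exists>c. \<forall>\<nu><length n. mask_lambda \<zeta> (T ! \<nu>) j = c * mask_lambda \<zeta> (S ! \<nu>) j"
    and D: "D \<in> sym_product n" "D' \<in> sym_product n"
    and eq: "mask_map \<zeta> n S D = mask_map \<zeta> n S D'"
  shows "mask_map \<zeta> n T D = mask_map \<zeta> n T D'"
proof -
  have z: "\<zeta> \<noteq> 0" using primitive_root_nonzero[OF \<zeta> assms(2)] .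
  obtain \<gamma> where ode: "\<And>D c. D \<in> sym_product n \<Longrightarrow> c \<noteq> 0 \<Longrightarrow>
      euler_op (mask_poly \<zeta> T D) * ode_den \<zeta> d (smult c (mask_poly \<zeta> S D))
        = mask_poly \<zeta> T D * ode_num \<zeta> d \<gamma> (smult c (mask_poly \<zeta> S D))"
    using ode_mask_poly[OF \<zeta> assms(2) len fin lines] by blast
  obtain b where b: "b \<noteq> 0" "mask_poly \<zeta> S D = smult b (mask_poly \<zeta> S D')"
    using eq by (auto simp: mask_map_eq(1)[OF _ len(1)] D proj_class_coeff_eq_iff)
  obtain c where c: "mask_poly \<zeta> T D = smult c (mask_poly \<zeta> T D')"
    using ode_solution_unique[OF z, of "mask_poly \<zeta> S D" "mask_poly \<zeta> T D'" d \<gamma> "mask_poly \<zeta> T D"]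
      ode[OF D(1), of 1] ode[OF D(2) b(1)] b(2)
      mask_poly_nonzero[OF z D(1) len(1)] mask_poly_nonzero[OF z D(2) len(2)] by auto
  have "c \<noteq> 0" using c mask_poly_nonzero[OF z D(1) len(2)] by auto
  then show ?thesis
    using c by (auto simp: mask_map_eq(1)[OF _ len(2)] D proj_class_coeff_eq_iff)
qed

text \<open>
  Compatibility prescribes the map on all of the image, whence uniqueness. By
  \<open>mask_map_determines\<close> the prescription is consistent, and by the same lemma with \<open>S\<close> and \<open>T\<close>
  exchanged it is injective. The map and its inverse are regular for the same reason.
\<close>

lemma compatible_iso_unique_existence:
  fixes \<zeta> :: "'a::field_char_0"
  assumes \<zeta>: "primitive_root_of_unity d \<zeta>" and "d > 0"
    and len: "length S = length n" "length T = length n"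
    and fin: "\<And>M. M \<in> set S \<Longrightarrow> finite M" "\<And>M. M \<in> set T \<Longrightarrow> finite M"
    and lines: "\<And>j. j < d \<Longrightarrow> \<exists>c. \<forall>\<nu><length n. mask_lambda \<zeta> (T ! \<nu>) j = c * mask_lambda \<zeta> (S ! \<nu>) j"
      "\<And>j. j < d \<Longrightarrow> \<exists>c. \<forall>\<nu><length n. mask_lambda \<zeta> (S ! \<nu>) j = c * mask_lambda \<zeta> (T ! \<nu>) j"
  shows "\<exists>!\<phi>. \<phi> \<in> extensional (mask_variety \<zeta> n S) \<and> compatible_iso \<zeta> n S T \<phi>"
proof (rule ex_ex1I)
  let ?Y = "mask_variety \<zeta> n S" and ?Z = "mask_variety \<zeta> n T"
  note ST = mask_map_determines[OF \<zeta> assms(2) len fin lines(1)]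
  note TS = mask_map_determines[OF \<zeta> assms(2) len(2,1) fin(2,1) lines(2)]
  define \<phi> where "\<phi> = restrict (\<lambda>y. mask_map \<zeta> n T (SOME D. D \<in> sym_product n \<and> mask_map \<zeta> n S D = y)) ?Y"
  have \<phi>: "\<phi> (mask_map \<zeta> n S D) = mask_map \<zeta> n T D" if "D \<in> sym_product n" for D
  proof -
    let ?D = "SOME D'. D' \<in> sym_product n \<and> mask_map \<zeta> n S D' = mask_map \<zeta> n S D"
    have "?D \<in> sym_product n \<and> mask_map \<zeta> n S ?D = mask_map \<zeta> n S D"
      by (rule someI[of _ D]) (simp add: that)
    then have "mask_map \<zeta> n T ?D = mask_map \<zeta> n T D" using ST[of ?D D] that by blast
    then show ?thesis using that by (simp add: \<phi>_def mask_variety_def)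
  qed
  have bij: "bij_betw \<phi> ?Y ?Z"
  proof (rule bij_betw_imageI)
    show "inj_on \<phi> ?Y"
    proof (rule inj_onI)
      fix y y' assume "y \<in> ?Y" "y' \<in> ?Y" and eq: "\<phi> y = \<phi> y'"
      then obtain D D' where D: "D \<in> sym_product n" "D' \<in> sym_product n"
        and y: "y = mask_map \<zeta> n S D" "y' = mask_map \<zeta> n S D'"
        by (auto simp: mask_variety_def)
      have "mask_map \<zeta> n T D = mask_map \<zeta> n T D'" using eq D by (simp add: y \<phi>)
      note TS[OF _ _ _ D this]
      then show "y = y'" unfolding y by simp
    qed
    show "\<phi> ` ?Y = ?Z"
      unfolding mask_variety_def image_image using \<phi> by (rule image_cong[OF refl])
  qed
  have inv: "inv_into ?Y \<phi> (mask_map \<zeta> n T D) = mask_map \<zeta> n S D" if "D \<in> sym_product n" for D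
    using inv_into_f_f[of \<phi> ?Y "mask_map \<zeta> n S D"] bij \<phi>[OF that] that
    by (simp add: bij_betw_def mask_variety_def)
  have "compatible_iso \<zeta> n S T \<phi>"
    unfolding compatible_iso_def variety_iso_def
  proof (intro conjI ballI)
    show "regular_map (form_degree n S) (form_degree n T) ?Y ?Z \<phi>"
      by (rule regular_map_if_lambda_proportional[OF \<zeta> assms(2) len fin lines(1) \<phi>])
    show "regular_map (form_degree n T) (form_degree n S) ?Z ?Y (inv_into ?Y \<phi>)"
      by (rule regular_map_if_lambda_proportional[OF \<zeta> assms(2) len(2,1) fin(2,1) lines(2) inv])
  qed (use bij \<phi> in auto)
  then show "\<exists>\<phi>. \<phi> \<in> extensional ?Y \<and> compatible_iso \<zeta> n S T \<phi>" by (auto simp: \<phi>_def)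
  fix \<phi> \<psi>
  assume "\<phi> \<in> extensional ?Y \<and> compatible_iso \<zeta> n S T \<phi>" "\<psi> \<in> extensional ?Y \<and> compatible_iso \<zeta> n S T \<psi>"
  then show "\<phi> = \<psi>"
    by (intro extensionalityI[of \<phi> ?Y \<psi>]) (auto simp: compatible_iso_def mask_variety_def)
qed

section \<open>Curves that detect the lines\<close>

definition affine_point :: "'a::field \<Rightarrow> 'a ppoint" where
  "affine_point z = proj_class (\<lambda>i. if i = 0 then z else if i = 1 then 1 else 0)"

lemma affine_point_in_proj_space: "affine_point z \<in> proj_space 1"
  unfolding affine_point_def proj_space_def
  by (rule CollectI, rule exI[of _ "\<lambda>i. if i = 0 then z else if i = 1 then 1 else 0"])
     (auto intro!: exI[of _ 1])

lemma point_coord_affine_point: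
  "\<exists>c. c \<noteq> 0 \<and> point_coord (affine_point z) 0 = c * z \<and> point_coord (affine_point z) 1 = c"
  using point_coord_proj_class[of "\<lambda>i. if i = 0 then z else if i = 1 then 1 else 0"]
  by (auto simp: affine_point_def)

text \<open>
  The polynomial \<open>X^(N-j) (X^j - c)\<close>, whose roots are the \<open>j\<close>-th roots of \<open>c\<close> and \<open>N - j\<close> zeros.
\<close>

definition curve_factor :: "nat \<Rightarrow> nat \<Rightarrow> 'a::comm_ring_1 \<Rightarrow> 'a poly" where
  "curve_factor N j c = monom 1 N - monom c (N - j)"

lemma curve_factor_roots:
  fixes c :: "'a::alg_closed_field"
  assumes "1 \<le> j" "j \<le> N"
  shows "\<exists>R. size R = N \<and> curve_factor N j c = (\<Prod>z\<in>#R. [:- z, 1:])"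
proof -
  have "degree (- monom c (N - j)) < degree (monom (1::'a) N)"
    using assms degree_monom_le[of c "N - j"] by (simp add: degree_monom_eq)
  then have "degree (curve_factor N j c) = N" "lead_coeff (curve_factor N j c) = 1"
    using assms by (simp_all add: curve_factor_def diff_conv_add_uminus degree_add_eq_left degree_monom_eq
      del: add_uminus_conv_diff)
  moreover then have "curve_factor N j c \<noteq> 0" by auto
  ultimately show ?thesis
    using alg_closed_imp_factorization[of "curve_factor N j c"] by (metis smult_1_left)
qed

text \<open>
  Multiplying all roots by \<open>e\<close> substitutes \<open>X/e\<close> for \<open>X\<close>; the set of \<open>j\<close>-th roots of \<open>c\<close> becomes that
  of \<open>e^j c\<close>.
\<close>

lemma curve_factor_rotate:
  fixes c e :: "'a::field"
  assumes "e \<noteq> 0" "j \<le> N" "curve_factor N j c = (\<Prod>z\<in>#R. [:- z, 1:])" "size R = N"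
  shows "(\<Prod>z\<in>#R. [:- (e * z), 1:]) = curve_factor N j (e ^ j * c)"
proof -
  have "smult (e ^ size R) (pcompose (\<Prod>z\<in>#R. [:- z, 1:]) [:0, inverse e:]) = (\<Prod>z\<in>#R. [:- (e * z), 1:])"
  proof (induction R)
    case (add z R)
    have "smult e (pcompose [:- z, 1:] [:0, inverse e:]) = [:- (e * z), 1:]"
      using assms(1) by (simp add: pcompose_pCons)
    moreover have "smult (e ^ Suc k) (pcompose (A * B) q) = smult e (pcompose A q) * smult (e ^ k) (pcompose B q)"
      for k A B q by (simp add: pcompose_mult mult.commute)
    ultimately show ?case
      unfolding image_mset_add_mset prod_mset.add_mset size_add_mset by (simp only: add.IH)
  qed (simp add: pcompose_1)
  then have "(\<Prod>z\<in>#R. [:- (e * z), 1:]) = smult (e ^ N) (pcompose (curve_factor N j c) [:0, inverse e:])"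
    using assms(3,4) by simp
  also have "\<dots> = curve_factor N j (e ^ j * c)"
  proof (rule poly_eqI)
    fix k
    have "e ^ N * inverse e ^ (N - j) = e ^ j"
    proof -
      have "e ^ N = e ^ j * e ^ (N - j)" using assms(2) by (simp flip: power_add)
      then show ?thesis using assms(1) by (simp add: power_inverse)
    qed
    moreover have "e ^ N * inverse e ^ N = 1" using assms(1) by (simp add: power_inverse)
    moreover have "coeff (smult (e ^ N) (pcompose (curve_factor N j c) [:0, inverse e:])) k
        = (if N = k then e ^ N * inverse e ^ N else 0) - (if N - j = k then e ^ N * inverse e ^ (N - j) * c else 0)"
      by (cases "N = k"; cases "N - j = k")
        (simp_all only: coeff_smult coeff_pcompose_linear curve_factor_def coeff_diff coeff_monom
          right_diff_distrib if_True if_False mult_zero_right mult_1_right mult.assoc simp_thms)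
    ultimately show "coeff (smult (e ^ N) (pcompose (curve_factor N j c) [:0, inverse e:])) k
        = coeff (curve_factor N j (e ^ j * c)) k"
      by (simp only: curve_factor_def coeff_diff coeff_monom)
  qed
  finally show ?thesis .
qed

text \<open>
  The family of forms along the curve, as a polynomial in \<open>X\<close> with coefficients in \<open>K[s]\<close>.
\<close>

definition curve_form :: "'a::field \<Rightarrow> nat list \<Rightarrow> nat set list \<Rightarrow> (nat \<Rightarrow> 'a) \<Rightarrow> nat \<Rightarrow> 'a poly poly" where
  "curve_form \<zeta> n S w j = (\<Prod>\<nu><length S. \<Prod>a\<in>S ! \<nu>. curve_factor (n ! \<nu>) j [:0, \<zeta> ^ (a * j) * w \<nu>:])"

text \<open>
  The point of the curve at time \<open>s\<close> depends only on \<open>n\<close>, \<open>j\<close> and \<open>w\<close>, so one \<open>D\<close> serves all mask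
  lists simultaneously.
\<close>

lemma mask_map_curve:
  fixes \<zeta> :: "'a::alg_closed_field"
  assumes "\<zeta> \<noteq> 0" "1 \<le> j" "\<And>\<nu>. \<nu> < length n \<Longrightarrow> j \<le> n ! \<nu>"
  shows "\<exists>D\<in>sym_product n. \<forall>S. length S = length n \<longrightarrow>
    mask_map \<zeta> n S D = proj_class (coeff (eval_inner s (curve_form \<zeta> n S w j)))"
proof -
  have "\<exists>R. \<nu> < length n \<longrightarrow> size R = n ! \<nu> \<and> curve_factor (n ! \<nu>) j (w \<nu> * s) = (\<Prod>z\<in>#R. [:- z, 1:])" for \<nu>
    using curve_factor_roots[OF assms(2) assms(3)[of \<nu>], of "w \<nu> * s"] by blast
  then obtain R where R: "\<And>\<nu>. \<nu> < length n \<Longrightarrow> size (R \<nu>) = n ! \<nu>"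
    "\<And>\<nu>. \<nu> < length n \<Longrightarrow> curve_factor (n ! \<nu>) j (w \<nu> * s) = (\<Prod>z\<in>#R \<nu>. [:- z, 1:])"
    by metis
  define D where "D = map (\<lambda>\<nu>. image_mset affine_point (R \<nu>)) [0..<length n]"
  have D: "D \<in> sym_product n"
    by (auto simp: sym_product_def D_def R(1) affine_point_in_proj_space[unfolded One_nat_def])
  moreover have "mask_map \<zeta> n S D = proj_class (coeff (eval_inner s (curve_form \<zeta> n S w j)))"
    if len: "length S = length n" for S
  proof -
    have "\<exists>c. \<forall>z::'a. c z \<noteq> 0 \<and> point_coord (affine_point z) 0 = c z * z
        \<and> point_coord (affine_point z) 1 = c z"
      by (intro choice allI point_coord_affine_point)
    then obtain c :: "'a \<Rightarrow> 'a" where c: "\<And>z. c z \<noteq> 0"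
        "\<And>z. point_coord (affine_point z) 0 = c z * z" "\<And>z. point_coord (affine_point z) 1 = c z"
      by blast
    define C where "C = (\<Prod>\<nu><length n. \<Prod>z\<in>#R \<nu>. \<Prod>a\<in>S ! \<nu>. c z)"
    have factor: "[: - (\<zeta> ^ a * point_coord (affine_point z) 0), point_coord (affine_point z) 1 :]
        = [:c z:] * [:- (\<zeta> ^ a * z), 1:]" for a z
      by (simp add: c c[unfolded One_nat_def])
    have "mask_poly \<zeta> S D = (\<Prod>\<nu><length n. \<Prod>z\<in>#R \<nu>. \<Prod>a\<in>S ! \<nu>.
        [: - (\<zeta> ^ a * point_coord (affine_point z) 0), point_coord (affine_point z) 1 :])"
      by (simp add: mask_poly_def D_def len image_mset.compositionality comp_def)
    also have "\<dots> = (\<Prod>\<nu><length n. \<Prod>z\<in>#R \<nu>. \<Prod>a\<in>S ! \<nu>. [:c z:] * [:- (\<zeta> ^ a * z), 1:])"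
      unfolding factor ..
    also have "\<dots> = (\<Prod>\<nu><length n. \<Prod>z\<in>#R \<nu>. \<Prod>a\<in>S ! \<nu>. [:c z:])
        * (\<Prod>\<nu><length n. \<Prod>z\<in>#R \<nu>. \<Prod>a\<in>S ! \<nu>. [:- (\<zeta> ^ a * z), 1:])"
      by (simp only: prod.distrib prod_mset.distrib)
    also have "(\<Prod>\<nu><length n. \<Prod>z\<in>#R \<nu>. \<Prod>a\<in>S ! \<nu>. [:c z:]) = [:C:]"
    proof -
      have const: "(\<Prod>i\<in>I. [:u i:]) = [:\<Prod>i\<in>I. u i:]" for I :: "nat set" and u :: "nat \<Rightarrow> 'a"
        by (induction I rule: infinite_finite_induct) (simp_all add: one_pCons mult_ac)
      have const_mset: "(\<Prod>i\<in>#I. [:u i:]) = [:\<Prod>i\<in>#I. u i:]" for I and u :: "'a \<Rightarrow> 'a"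
        by (induction I) (simp_all add: one_pCons mult_ac)
      show ?thesis by (simp only: const const_mset C_def)
    qed
    also have "(\<Prod>\<nu><length n. \<Prod>z\<in>#R \<nu>. \<Prod>a\<in>S ! \<nu>. [:- (\<zeta> ^ a * z), 1:])
        = eval_inner s (curve_form \<zeta> n S w j)"
    proof -
      have swap: "(\<Prod>z\<in>#A. \<Prod>a\<in>I. u z a) = (\<Prod>a\<in>I. \<Prod>z\<in>#A. u z a)"
        for A :: "'a multiset" and I :: "nat set" and u :: "'a \<Rightarrow> nat \<Rightarrow> 'a poly"
        by (induction A) (simp_all add: prod.distrib)
      have "(\<Prod>z\<in>#R \<nu>. [:- (\<zeta> ^ a * z), 1:]) = curve_factor (n ! \<nu>) j (\<zeta> ^ (a * j) * w \<nu> * s)"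
        if "\<nu> < length n" for \<nu> a
        using curve_factor_rotate[OF _ assms(3)[OF that] R(2)[OF that] R(1)[OF that], of "\<zeta> ^ a"] assms(1)
        by (simp add: power_mult mult_ac)
      moreover have "eval_inner s (curve_factor N j [:0, u:]) = curve_factor N j (u * s)" for N u
        by (rule poly_eqI) (simp add: coeff_eval_inner curve_factor_def coeff_monom mult.commute)
      ultimately show ?thesis
        by (simp add: curve_form_def eval_inner_prod swap len)
    qed
    finally have "mask_poly \<zeta> S D = smult C (eval_inner s (curve_form \<zeta> n S w j))" by simp
    moreover have "C \<noteq> 0"
    proof -
      have "(\<Prod>a\<in>I. c z) \<noteq> 0" for I :: "nat set" and z
        by (cases "finite I") (simp_all add: c)
      then show ?thesis by (auto simp: C_def prod_mset_zero_iff)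
    qed
    ultimately show ?thesis
      unfolding mask_map_eq(1)[OF D len] proj_class_coeff_eq_iff by blast
  qed
  ultimately show ?thesis by blast
qed

text \<open>
  Expansion modulo \<open>s^2\<close>. If \<open>A\<close> is empty, then \<open>(\<Sum>i\<in>A. N i) - j\<close> is truncated, but its coefficient
  is zero.
\<close>

lemma curve_product_first_order:
  fixes c :: "'i \<Rightarrow> 'a::comm_ring_1"
  assumes "\<And>i. i \<in> A \<Longrightarrow> j \<le> N i"
  shows "\<exists>R. (\<Prod>i\<in>A. curve_factor (N i) j [:0, c i:])
      = monom 1 (\<Sum>i\<in>A. N i) - monom [:0, \<Sum>i\<in>A. c i:] ((\<Sum>i\<in>A. N i) - j) + smult (monom 1 2) R"
  using assms
proof (induction A rule: infinite_finite_induct)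
  case (insert i A)
  let ?M = "\<Sum>i\<in>A. N i" and ?c = "\<Sum>i\<in>A. c i"
  obtain R where R: "(\<Prod>i\<in>A. curve_factor (N i) j [:0, c i:])
      = monom 1 ?M - monom [:0, ?c:] (?M - j) + smult (monom 1 2) R"
    using insert by auto
  have j: "j \<le> N i" using insert.prems by simp
  have shift: "monom [:0, ?c:] (N i + (?M - j)) = monom [:0, ?c:] (N i + ?M - j)"
  proof (cases "A = {}")
    case False
    then obtain k where "k \<in> A" by blast
    then have "j \<le> N k" "N k \<le> ?M" using insert.prems insert.hyps(1) by (auto intro: member_le_sum)
    then show ?thesis by simp
  qed simp
  have "curve_factor (N i) j [:0, c i:] * (monom 1 ?M - monom [:0, ?c:] (?M - j) + smult (monom 1 2) R)
      = monom 1 (N i + ?M) - (monom [:0, c i:] (N i + ?M - j) + monom [:0, ?c:] (N i + (?M - j)))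
        + (monom ([:0, c i:] * [:0, ?c:]) (N i - j + (?M - j))
          + smult (monom 1 2) (R * curve_factor (N i) j [:0, c i:]))"
    using j by (simp add: curve_factor_def algebra_simps mult_monom smult_diff_right)
  also have "monom ([:0, c i:] * [:0, ?c:]) (N i - j + (?M - j))
      = smult (monom 1 2) (monom [:c i * ?c:] (N i - j + (?M - j)))"
    by (simp add: smult_monom monom_altdef power2_eq_square mult.commute)
  also have "monom [:0, c i:] (N i + ?M - j) + monom [:0, ?c:] (N i + (?M - j))
      = monom [:0, c i + ?c:] (N i + ?M - j)"
    by (simp add: shift add_monom)
  finally show ?case
    using insert.hyps by (auto simp: R simp flip: smult_add_right)
qed (auto simp: one_pCons monom_0 intro!: exI[of _ 0])

lemma curve_form_first_order:
  fixes \<zeta> :: "'a::field"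
  assumes "length S = length n" "\<And>M. M \<in> set S \<Longrightarrow> finite M" "\<And>\<nu>. \<nu> < length n \<Longrightarrow> j \<le> n ! \<nu>"
  shows "\<exists>R. curve_form \<zeta> n S w j = monom 1 (form_degree n S)
    - monom [:0, \<Sum>\<nu><length n. w \<nu> * mask_lambda \<zeta> (S ! \<nu>) j:] (form_degree n S - j) + smult (monom 1 2) R"
proof -
  let ?I = "SIGMA \<nu>:{..<length n}. S ! \<nu>"
  have fin: "\<forall>\<nu>\<in>{..<length n}. finite (S ! \<nu>)" using assms(1,2) by auto
  have 1: "curve_form \<zeta> n S w j = (\<Prod>i\<in>?I. curve_factor (n ! fst i) j [:0, \<zeta> ^ (snd i * j) * w (fst i):])"
    using fin by (simp add: curve_form_def prod.Sigma assms(1) case_prod_beta)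
  have 2: "(\<Sum>i\<in>?I. n ! fst i) = form_degree n S"
  proof -
    have "form_degree n S = (\<Sum>\<nu><length n. \<Sum>a\<in>S ! \<nu>. n ! \<nu>)"
      by (simp add: form_degree_def assms(1) mult.commute)
    also have "\<dots> = (\<Sum>i\<in>?I. n ! fst i)"
      by (subst sum.Sigma) (use fin in \<open>simp_all add: case_prod_beta\<close>)
    finally show ?thesis by simp
  qed
  have 3: "(\<Sum>i\<in>?I. \<zeta> ^ (snd i * j) * w (fst i)) = (\<Sum>\<nu><length n. w \<nu> * mask_lambda \<zeta> (S ! \<nu>) j)"
  proof -
    have "(\<Sum>\<nu><length n. w \<nu> * mask_lambda \<zeta> (S ! \<nu>) j) = (\<Sum>\<nu><length n. \<Sum>a\<in>S ! \<nu>. \<zeta> ^ (a * j) * w \<nu>)"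
      by (simp add: mask_lambda_def sum_distrib_left mult.commute)
    also have "\<dots> = (\<Sum>i\<in>?I. \<zeta> ^ (snd i * j) * w (fst i))"
      by (subst sum.Sigma) (use fin in \<open>simp_all add: case_prod_beta\<close>)
    finally show ?thesis by simp
  qed
  show ?thesis
    using curve_product_first_order[of ?I j "\<lambda>i. n ! fst i" "\<lambda>i. \<zeta> ^ (snd i * j) * w (fst i)"] assms(3)
    unfolding 1 2 3 by auto
qed

lemma coeff_mult_1: "coeff (p * q) 1 = coeff p 0 * coeff q 1 + coeff p 1 * coeff q 0"
  by (simp add: coeff_mult)

text \<open>
  Polynomials in \<open>s\<close> with vanishing linear coefficient form a subring.
\<close>

lemma mpoly_eval_stationary:
  fixes p :: "nat \<Rightarrow> 'a::comm_ring_1 poly"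
  assumes "\<And>i. coeff (p i) 1 = 0"
  shows "\<exists>Q. coeff Q 1 = 0 \<and> (\<forall>s. mpoly_eval F (\<lambda>i. poly (p i) s) = poly Q s)"
proof -
  have pow: "coeff (q ^ k) 1 = 0" if "coeff q 1 = 0" for q :: "'a poly" and k
    using that by (induction k) (simp_all add: coeff_mult_1[unfolded One_nat_def])
  have prod: "coeff (\<Prod>i\<in>I. q i) 1 = 0" if "\<And>i. coeff (q i) 1 = 0" for I and q :: "nat \<Rightarrow> 'a poly"
    using that by (induction I rule: infinite_finite_induct) (simp_all add: coeff_mult_1[unfolded One_nat_def])
  define Q where "Q = (\<Sum>e\<in>Poly_Mapping.keys F. smult (Poly_Mapping.lookup F e)
    (\<Prod>i\<in>Poly_Mapping.keys e. p i ^ Poly_Mapping.lookup e i))"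
  have "coeff Q 1 = 0"
    using prod[OF pow[OF assms]] by (simp add: Q_def coeff_sum)
  moreover have "mpoly_eval F (\<lambda>i. poly (p i) s) = poly Q s" for s
    by (simp add: Q_def mpoly_eval_def poly_sum poly_prod)
  ultimately show ?thesis by blast
qed

text \<open>
  In a neighbourhood of \<open>s = 0\<close> the coordinates \<open>y\<^sub>i(s)\<close> of the image curve are proportional to
  polynomials \<open>Q\<^sub>i(s)\<close> without linear term, because the coordinates \<open>x(s)\<close> have none. Cross
  multiplication of the coordinates \<open>k\<close> and \<open>k - j\<close> gives an identity of polynomials in \<open>s\<close>, and its
  linear coefficient is the claim: \<open>y\<^sub>k\<close> starts with \<open>1\<close>, and \<open>y\<^bsub>k-j\<^esub>\<close> starts with \<open>- \<mu> s\<close>.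
\<close>

lemma regular_map_first_order:
  fixes \<zeta> :: "'a::{alg_closed_field, field_char_0}"
  assumes z: "\<zeta> \<noteq> 0" and len: "length S = length n" "length T = length n"
    and fin: "\<And>M. M \<in> set S \<Longrightarrow> finite M" "\<And>M. M \<in> set T \<Longrightarrow> finite M"
    and T_nonempty: "\<And>M. M \<in> set T \<Longrightarrow> M \<noteq> {}"
    and j: "1 \<le> j" "\<And>\<nu>. \<nu> < length n \<Longrightarrow> j \<le> n ! \<nu>"
    and reg: "regular_map (form_degree n S) (form_degree n T) (mask_variety \<zeta> n S) (mask_variety \<zeta> n T) \<phi>"
    and \<phi>: "\<And>D. D \<in> sym_product n \<Longrightarrow> \<phi> (mask_map \<zeta> n S D) = mask_map \<zeta> n T D"
    and w: "(\<Sum>\<nu><length n. w \<nu> * mask_lambda \<zeta> (S ! \<nu>) j) = 0"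
  shows "(\<Sum>\<nu><length n. w \<nu> * mask_lambda \<zeta> (T ! \<nu>) j) = 0"
proof (cases "n = []")
  case False
  let ?m = "form_degree n S" and ?k = "form_degree n T"
  define \<mu> where "\<mu> = (\<Sum>\<nu><length n. w \<nu> * mask_lambda \<zeta> (T ! \<nu>) j)"
  define f where "f = coeff (curve_form \<zeta> n S w j)"
  define h where "h = coeff (curve_form \<zeta> n T w j)"
  define x where "x s = (\<lambda>i. poly (f i) s)" for s
  define y where "y s = (\<lambda>i. poly (h i) s)" for s
  have j_le: "j \<le> ?k"
  proof -
    have "T ! 0 \<in> set T" using False len by simp
    then have "card (T ! 0) \<ge> 1" using fin(2) T_nonempty by (metis One_nat_def Suc_leI card_gt_0_iff)
    then have "j \<le> n ! 0 * card (T ! 0)" using j(2)[of 0] False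
      by (metis length_greater_0_conv mult.right_neutral mult_le_mono)
    also have "\<dots> \<le> ?k"
      unfolding form_degree_def using False len by (intro member_le_sum) auto
    finally show ?thesis .
  qed
  obtain R where R: "curve_form \<zeta> n S w j = monom 1 ?m + smult (monom 1 2) R"
    using curve_form_first_order[OF len(1) fin(1) j(2), where \<zeta> = \<zeta> and w = w] w by auto
  obtain R' where R': "curve_form \<zeta> n T w j = monom 1 ?k - monom [:0, \<mu>:] (?k - j) + smult (monom 1 2) R'"
    using curve_form_first_order[OF len(2) fin(2) j(2), where \<zeta> = \<zeta> and w = w] unfolding \<mu>_def by auto
  have f1: "coeff (f i) 1 = 0" for i
    by (simp add: f_def R coeff_monom_mult coeff_eq_0)
  have h_k: "coeff (h ?k) 0 = 1" "coeff (h ?k) 1 = 0"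
    using j j_le by (simp_all add: h_def R' coeff_monom_mult)
  have h_kj: "coeff (h (?k - j)) 0 = 0" "coeff (h (?k - j)) 1 = - \<mu>"
    using j j_le by (simp_all add: h_def R' coeff_monom_mult)
  have point: "\<phi> (proj_class (x s)) = proj_class (y s) \<and> proj_class (x s) \<in> mask_variety \<zeta> n S" for s
  proof -
    obtain D where D: "D \<in> sym_product n" "\<forall>S. length S = length n \<longrightarrow>
        mask_map \<zeta> n S D = proj_class (coeff (eval_inner s (curve_form \<zeta> n S w j)))"
      using mask_map_curve[OF z j, where s = s and w = w] by blast
    have "x s = coeff (eval_inner s (curve_form \<zeta> n S w j))" "y s = coeff (eval_inner s (curve_form \<zeta> n T w j))"
      by (simp_all add: x_def y_def f_def h_def coeff_eval_inner fun_eq_iff)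
    then show ?thesis using \<phi>[OF D(1)] D len by (auto simp: mask_variety_def)
  qed
  obtain U r F where U: "zariski_open ?m U" "proj_class (x 0) \<in> U"
    and F: "\<forall>q\<in>mask_variety \<zeta> n S \<inter> U. \<forall>x\<in>q.
      (\<exists>i\<le>?k. mpoly_eval (F i) x \<noteq> 0) \<and> \<phi> q = proj_class (\<lambda>i. if i \<le> ?k then mpoly_eval (F i) x else 0)"
    using bspec[OF conjunct2[OF reg[unfolded regular_map_def]], of "proj_class (x 0)"] point[of 0]
    by blast
  obtain \<G> where \<G>: "\<G> \<subseteq> (\<Union>r. homogeneous_polys ?m r)"
    "U = {p \<in> proj_space ?m. \<exists>G\<in>\<G>. \<forall>x\<in>p. mpoly_eval G x \<noteq> 0}"
    using U(1) unfolding zariski_open_def by blast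
  obtain G where G: "G \<in> \<G>" "mpoly_eval G (x 0) \<noteq> 0"
    using U(2) self_mem_proj_class unfolding \<G>(2) by blast
  obtain q where Gq: "mpoly_eval G \<in> form_functions ?m q"
    using G(1) \<G>(1) unfolding form_functions_def by blast
  \<comment> \<open>The curve stays in the neighbourhood \<open>U\<close> off the finitely many roots of \<open>g\<close>.\<close>
  obtain g where g: "\<And>s. mpoly_eval G (x s) = poly g s"
    using mpoly_eval_stationary[of f G, OF f1] unfolding x_def by blast
  have "g \<noteq> 0" using G(2) unfolding g by auto
  have "\<exists>Q. coeff Q 1 = 0 \<and> (\<forall>s. mpoly_eval (F i) (x s) = poly Q s)" for i
    unfolding x_def by (rule mpoly_eval_stationary[OF f1])
  then obtain Q where Q: "\<And>i. coeff (Q i) 1 = 0" "\<And>i s. mpoly_eval (F i) (x s) = poly (Q i) s"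
    by metis
  have local: "\<exists>c. \<forall>i\<le>?k. y s i = c * poly (Q i) s" if s: "poly g s \<noteq> 0" for s
  proof -
    have "mpoly_eval G (\<lambda>i. c * x s i) \<noteq> 0" if "c \<noteq> 0" for c
      using form_function_homogeneous[OF Gq, of c "x s"] s that by (simp add: g)
    moreover have "proj_class (x s) \<in> proj_space ?m"
      using point[of s] mask_map_in_proj_space[OF z _ len(1)] by (auto simp: mask_variety_def)
    ultimately have "proj_class (x s) \<in> U"
      unfolding \<G>(2) using G(1) by (auto simp: proj_class_def)
    then have "proj_class (y s) = proj_class (\<lambda>i. if i \<le> ?k then mpoly_eval (F i) (x s) else 0)"
      using F point[of s] self_mem_proj_class[of "x s"] by auto
    then obtain c where "y s = (\<lambda>i. c * (if i \<le> ?k then mpoly_eval (F i) (x s) else 0))"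
      unfolding proj_class_eq_iff by blast
    then show ?thesis by (auto simp: Q(2))
  qed
  have "Q ?k * h (?k - j) = Q (?k - j) * h ?k"
  proof (rule poly_eq_off_roots[OF \<open>g \<noteq> 0\<close>])
    fix s assume "poly g s \<noteq> 0"
    then obtain c where c: "\<forall>i\<le>?k. y s i = c * poly (Q i) s" using local by blast
    have "y s ?k = c * poly (Q ?k) s" "y s (?k - j) = c * poly (Q (?k - j)) s" using c by simp_all
    then show "poly (Q ?k * h (?k - j)) s = poly (Q (?k - j) * h ?k) s" by (simp add: y_def)
  qed
  then have "coeff (Q ?k * h (?k - j)) 1 = coeff (Q (?k - j) * h ?k) 1" by simp
  then have "coeff (Q ?k) 0 * \<mu> = 0"
    using Q(1) h_k h_kj unfolding coeff_mult_1 by simp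
  moreover have "coeff (Q ?k) 0 \<noteq> 0"
  proof -
    have "poly g 0 \<noteq> 0" using G(2) unfolding g .
    then obtain c where "y 0 ?k = c * poly (Q ?k) 0" using local by blast
    moreover have "y 0 ?k = 1" using h_k(1) by (simp add: y_def poly_0_coeff_0)
    ultimately show ?thesis by (auto simp: poly_0_coeff_0)
  qed
  ultimately show ?thesis unfolding \<mu>_def by simp
qed simp

text \<open>
  If \<open>a\<close> has a nonzero entry \<open>a\<^sub>\<mu>\<close>, the annihilators with two entries \<open>a\<^sub>\<mu>\<close> and \<open>- a\<^sub>\<nu>\<close> suffice;
  otherwise the unit vectors annihilate \<open>a\<close>.
\<close>

lemma proportional_if_annihilators_subset:
  fixes a b :: "nat \<Rightarrow> 'a::field"
  assumes "\<And>w. (\<Sum>\<nu><t. w \<nu> * a \<nu>) = 0 \<Longrightarrow> (\<Sum>\<nu><t. w \<nu> * b \<nu>) = 0"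
  shows "\<exists>c. \<forall>\<nu><t. b \<nu> = c * a \<nu>"
proof (cases "\<exists>\<mu><t. a \<mu> \<noteq> 0")
  case True
  then obtain \<mu> where \<mu>: "\<mu> < t" "a \<mu> \<noteq> 0" by blast
  have "b \<nu> = b \<mu> / a \<mu> * a \<nu>" if \<nu>: "\<nu> < t" for \<nu>
  proof -
    define w where "w k = (if k = \<nu> then a \<mu> else 0) - (if k = \<mu> then a \<nu> else 0)" for k
    have "(\<Sum>k<t. w k * u k) = a \<mu> * u \<nu> - a \<nu> * u \<mu>" for u :: "nat \<Rightarrow> 'a"
    proof -
      have "(\<Sum>k<t. w k * u k) = (\<Sum>k<t. (if k = \<nu> then a \<mu> * u \<nu> else 0) - (if k = \<mu> then a \<nu> * u \<mu> else 0))"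
        by (intro sum.cong refl) (simp add: w_def)
      then show ?thesis using \<mu>(1) \<nu> by (simp add: sum_subtractf)
    qed
    then have "a \<mu> * b \<nu> - a \<nu> * b \<mu> = 0" using assms[of w] by (simp add: mult.commute)
    then show ?thesis using \<mu>(2) by (simp add: field_simps)
  qed
  then show ?thesis by blast
next
  case False
  have "b \<nu> = 0" if "\<nu> < t" for \<nu>
  proof -
    have "(\<Sum>k<t. (if k = \<nu> then 1 else 0) * b k) = 0"
      using assms[of "\<lambda>k. if k = \<nu> then 1 else 0"] False by simp
    then show ?thesis using that by (simp add: if_distrib[of "\<lambda>x. x * _"] cong: if_cong)
  qed
  then show ?thesis by (intro exI[of _ 0]) simp
qed

text \<open>
  Equality is split into the two inclusions: the vector of one list is a multiple of that of the
  other. This form also covers zero vectors.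
\<close>

lemma lambda_line_eq_iff:
  assumes len: "length S = length n" "length T = length n"
  shows "lambda_line \<zeta> S j = lambda_line \<zeta> T j \<longleftrightarrow>
    (\<exists>c. \<forall>\<nu><length n. mask_lambda \<zeta> (T ! \<nu>) j = c * mask_lambda \<zeta> (S ! \<nu>) j) \<and>
    (\<exists>c. \<forall>\<nu><length n. mask_lambda \<zeta> (S ! \<nu>) j = c * mask_lambda \<zeta> (T ! \<nu>) j)"
proof -
  have sub: "lambda_line \<zeta> A j \<subseteq> lambda_line \<zeta> B j \<longleftrightarrow>
      (\<exists>c. \<forall>\<nu><length n. mask_lambda \<zeta> (A ! \<nu>) j = c * mask_lambda \<zeta> (B ! \<nu>) j)"
    if AB: "length A = length n" "length B = length n" for A B
  proof
    assume "lambda_line \<zeta> A j \<subseteq> lambda_line \<zeta> B j"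
    moreover have "map (\<lambda>M. 1 * mask_lambda \<zeta> M j) A \<in> lambda_line \<zeta> A j"
      unfolding lambda_line_def by blast
    ultimately obtain c where "map (\<lambda>M. 1 * mask_lambda \<zeta> M j) A = map (\<lambda>M. c * mask_lambda \<zeta> M j) B"
      unfolding lambda_line_def by blast
    then show "\<exists>c. \<forall>\<nu><length n. mask_lambda \<zeta> (A ! \<nu>) j = c * mask_lambda \<zeta> (B ! \<nu>) j"
      using AB by (auto simp: list_eq_iff_nth_eq)
  next
    assume "\<exists>c. \<forall>\<nu><length n. mask_lambda \<zeta> (A ! \<nu>) j = c * mask_lambda \<zeta> (B ! \<nu>) j"
    then obtain c where "\<forall>\<nu><length n. mask_lambda \<zeta> (A ! \<nu>) j = c * mask_lambda \<zeta> (B ! \<nu>) j" ..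
    then have "map (\<lambda>M. b * mask_lambda \<zeta> M j) A = map (\<lambda>M. (b * c) * mask_lambda \<zeta> M j) B" for b
      using AB by (auto simp: list_eq_iff_nth_eq)
    then show "lambda_line \<zeta> A j \<subseteq> lambda_line \<zeta> B j" unfolding lambda_line_def by blast
  qed
  show ?thesis using sub[OF len] sub[OF len(2,1)] by blast
qed

lemma compatible_iso_imp_lambda_line_eq:
  fixes \<zeta> :: "'a::{alg_closed_field, field_char_0}"
  assumes z: "\<zeta> \<noteq> 0" and len: "length S = length n" "length T = length n"
    and masks: "\<And>M. M \<in> set S \<union> set T \<Longrightarrow> finite M \<and> M \<noteq> {}"
    and j: "1 \<le> j" "\<And>\<nu>. \<nu> < length n \<Longrightarrow> j \<le> n ! \<nu>"
    and iso: "compatible_iso \<zeta> n S T \<phi>"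
  shows "lambda_line \<zeta> S j = lambda_line \<zeta> T j"
proof -
  let ?Y = "mask_variety \<zeta> n S" and ?Z = "mask_variety \<zeta> n T"
  have bij: "bij_betw \<phi> ?Y ?Z"
    and reg: "regular_map (form_degree n S) (form_degree n T) ?Y ?Z \<phi>"
    and reg': "regular_map (form_degree n T) (form_degree n S) ?Z ?Y (inv_into ?Y \<phi>)"
    and \<phi>: "\<And>D. D \<in> sym_product n \<Longrightarrow> \<phi> (mask_map \<zeta> n S D) = mask_map \<zeta> n T D"
    using iso by (auto simp: compatible_iso_def variety_iso_def)
  have inv: "inv_into ?Y \<phi> (mask_map \<zeta> n T D) = mask_map \<zeta> n S D" if "D \<in> sym_product n" for D
    using inv_into_f_f[of \<phi> ?Y "mask_map \<zeta> n S D"] bij \<phi>[OF that] that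
    by (simp add: bij_betw_def mask_variety_def)
  have fin: "\<And>M. M \<in> set S \<Longrightarrow> finite M" "\<And>M. M \<in> set T \<Longrightarrow> finite M"
    and ne: "\<And>M. M \<in> set S \<Longrightarrow> M \<noteq> {}" "\<And>M. M \<in> set T \<Longrightarrow> M \<noteq> {}"
    using masks by auto
  have "\<exists>c. \<forall>\<nu><length n. mask_lambda \<zeta> (T ! \<nu>) j = c * mask_lambda \<zeta> (S ! \<nu>) j"
    by (rule proportional_if_annihilators_subset)
       (rule regular_map_first_order[OF z len fin ne(2) j reg \<phi>])
  moreover have "\<exists>c. \<forall>\<nu><length n. mask_lambda \<zeta> (S ! \<nu>) j = c * mask_lambda \<zeta> (T ! \<nu>) j"
    by (rule proportional_if_annihilators_subset)
       (rule regular_map_first_order[OF z len(2,1) fin(2,1) ne(1) j reg' inv])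
  ultimately show ?thesis unfolding lambda_line_eq_iff[OF len] by blast
qed

section \<open>Conjugate roots of unity\<close>

definition int_eval :: "int poly \<Rightarrow> 'a::field_char_0 \<Rightarrow> 'a" where
  "int_eval P z = poly (map_poly of_int P) z"

lemma int_eval_add [simp]: "int_eval (P + Q) z = int_eval P z + int_eval Q z"
proof -
  have "map_poly (of_int :: int \<Rightarrow> 'a) (P + Q) = map_poly of_int P + map_poly of_int Q"
    by (rule poly_eqI) (simp add: coeff_map_poly)
  then show ?thesis by (simp add: int_eval_def)
qed

lemma int_eval_mult [simp]: "int_eval (P * Q) z = int_eval P z * int_eval Q z"
proof -
  have "map_poly (of_int :: int \<Rightarrow> 'a) (P * Q) = map_poly of_int P * map_poly of_int Q"
    by (rule poly_eqI) (simp add: coeff_map_poly coeff_mult)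
  then show ?thesis by (simp add: int_eval_def)
qed

lemma int_eval_pCons [simp]: "int_eval (pCons a P) z = of_int a + z * int_eval P z"
  by (simp add: int_eval_def map_poly_pCons)

lemma int_eval_0 [simp]: "int_eval 0 z = 0"
  by (simp add: int_eval_def)

lemma int_eval_1 [simp]: "int_eval 1 z = 1"
  using int_eval_pCons[of 1 0 z] by (simp add: one_pCons)

lemma int_eval_smult [simp]: "int_eval (smult c P) z = of_int c * int_eval P z"
  using int_eval_mult[of "[:c:]" P z] by simp

lemma int_eval_diff [simp]: "int_eval (P - Q) z = int_eval P z - int_eval Q z"
  using int_eval_add[of "P - Q" Q z] by simp

lemma int_eval_of_nat [simp]: "int_eval (of_nat m) z = of_nat m"
  by (induction m) simp_all

lemma int_eval_power [simp]: "int_eval (P ^ k) z = int_eval P z ^ k"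
  by (induction k) simp_all

lemma int_eval_monom [simp]: "int_eval (monom c k) z = of_int c * z ^ k"
  by (simp add: int_eval_def map_poly_monom poly_monom)

lemma int_eval_sum [simp]: "int_eval (sum f A) z = (\<Sum>i\<in>A. int_eval (f i) z)"
  by (induction A rule: infinite_finite_induct) simp_all

lemma int_eval_pderiv_unit_power:
  "int_eval (pderiv (monom 1 N - 1)) z = of_nat N * z ^ (N - 1)"
  by (simp add: pderiv_diff pderiv_monom)

lemma binomial_power_prime:
  fixes A B :: "'a::comm_ring_1"
  assumes "prime p"
  shows "\<exists>H. (A + B) ^ p = A ^ p + B ^ p + of_nat p * H"
proof -
  have p0: "p > 0" using assms prime_gt_0_nat by blast
  define t where "t k = of_nat (p choose k) * A ^ k * B ^ (p - k)" for k
  have "\<exists>h. t k = of_nat p * h" if "k \<in> {1..<p}" for k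
  proof -
    have "p dvd p choose k"
      using that assms by (intro dvd_choose_prime) auto
    then obtain c where c: "p choose k = p * c" ..
    have "t k = of_nat p * (of_nat c * A ^ k * B ^ (p - k))"
      by (simp add: t_def c mult.assoc)
    then show ?thesis ..
  qed
  then obtain h where h: "\<And>k. k \<in> {1..<p} \<Longrightarrow> t k = of_nat p * h k" by metis
  have "(A + B) ^ p = (\<Sum>k\<le>p. t k)"
    by (simp add: binomial_ring t_def)
  also have "{..p} = insert 0 (insert p {1..<p})" using p0 by auto
  also have "(\<Sum>k\<in>insert 0 (insert p {1..<p}). t k) = t 0 + (t p + (\<Sum>k\<in>{1..<p}. t k))"
    using p0 by (subst sum.insert; simp)
  also have "(\<Sum>k\<in>{1..<p}. t k) = of_nat p * (\<Sum>k\<in>{1..<p}. h k)"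
    using h by (simp add: sum_distrib_left)
  finally have "(A + B) ^ p = A ^ p + B ^ p + of_nat p * (\<Sum>k\<in>{1..<p}. h k)"
    by (simp add: t_def)
  then show ?thesis ..
qed

lemma fermat_int:
  fixes a :: int
  assumes "prime p"
  shows "int p dvd a ^ p - a"
proof -
  have p0: "p > 0" using assms prime_gt_0_nat by blast
  have step: "int p dvd (x + 1) ^ p - (x + 1) \<longleftrightarrow> int p dvd x ^ p - x" for x :: int
  proof -
    obtain H where "(x + 1) ^ p = x ^ p + 1 ^ p + int p * H"
      using binomial_power_prime[OF assms] by metis
    then have "(x + 1) ^ p - (x + 1) = (x ^ p - x) + int p * H" by simp
    then show ?thesis by (metis dvd_add_left_iff dvd_triv_left)
  qed
  show ?thesis
  proof (induction a rule: int_induct[where k = 0])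
    case base
    then show ?case using p0 by (simp add: zero_power)
  next
    case (step1 i)
    then show ?case using step by blast
  next
    case (step2 i)
    then show ?case using step[of "i - 1"] by simp
  qed
qed

text \<open>
  Modulo \<open>p\<close> the Frobenius map commutes with evaluation, since it is additive and fixes the integers.
\<close>

lemma int_eval_frobenius:
  assumes "prime p"
  shows "\<exists>g. \<forall>z::'a::field_char_0. int_eval f (z ^ p) = int_eval f z ^ p + of_nat p * int_eval g z"
proof (induction f)
  case 0
  have "p > 0" using assms prime_gt_0_nat by blast
  then show ?case by (intro exI[of _ 0]) simp
next
  case (pCons a f)
  then obtain g where g: "\<And>z::'a. int_eval f (z ^ p) = int_eval f z ^ p + of_nat p * int_eval g z"
    by blast
  obtain H where H: "([:a:] + pCons 0 f) ^ p = [:a:] ^ p + pCons 0 f ^ p + of_nat p * H"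
    using binomial_power_prime[OF assms] by blast
  obtain c where c: "a ^ p - a = int p * c"
    using fermat_int[OF assms] by (meson dvdE)
  have c': "(of_int a :: 'a) ^ p = of_int a + of_nat p * of_int c"
  proof -
    have "a ^ p = a + int p * c" using c by simp
    then have "(of_int (a ^ p) :: 'a) = of_int (a + int p * c)" by simp
    then show ?thesis by simp
  qed
  have "int_eval (pCons a f) (z ^ p)
      = int_eval (pCons a f) z ^ p + of_nat p * int_eval (monom 1 p * g - [:c:] - H) z" for z :: 'a
  proof -
    have "int_eval (pCons a f) z ^ p = int_eval (([:a:] + pCons 0 f) ^ p) z" by simp
    also have "\<dots> = of_int a ^ p + z ^ p * int_eval f z ^ p + of_nat p * int_eval H z"
      unfolding H by (simp add: power_mult_distrib)
    finally show ?thesis by (simp add: g c' algebra_simps)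
  qed
  then show ?case by blast
qed

text \<open>
  Pseudo-division by an annihilating polynomial \<open>g\<close> of least degree shows that \<open>g\<close> divides a multiple
  \<open>a P\<close> of every annihilating polynomial. In particular \<open>a f = g q\<close> for some \<open>a\<close>. The prime element
  \<open>f\<close> cannot divide \<open>q\<close>, since then \<open>g\<close> would be constant; so it divides \<open>g\<close>, hence a multiple \<open>a P\<close>
  of \<open>P\<close>, and finally \<open>P\<close>, because it divides no nonzero constant.
\<close>

lemma irreducible_annihilator_dvd:
  fixes f P :: "int poly" and \<omega> :: "'a::field_char_0"
  assumes "irreducible f" "int_eval f \<omega> = 0" "int_eval P \<omega> = 0"
  shows "f dvd P"
proof -
  have prime: "prime_elem f" using assms(1) by (rule irreducible_imp_prime_poly)
  have f0: "f \<noteq> 0" using assms(1) by auto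
  define Z where "Z g \<longleftrightarrow> g \<noteq> 0 \<and> int_eval g \<omega> = 0" for g
  obtain g where g: "Z g" and min: "\<And>h. Z h \<Longrightarrow> degree g \<le> degree h"
    using exists_least_iff[of "\<lambda>k. \<exists>g. Z g \<and> degree g = k"] assms(2) f0
    by (metis Z_def not_less)
  have g0: "g \<noteq> 0" using g by (simp add: Z_def)
  have no_const: "\<not> f dvd [:c:]" if "c \<noteq> 0" for c
  proof
    assume "f dvd [:c:]"
    then obtain h where "[:c:] = f * h" ..
    then have "int_eval [:c:] \<omega> = 0" using assms(2) by simp
    then show False using that by simp
  qed
  have div: "\<exists>a q. a \<noteq> 0 \<and> smult a h = g * q" if "int_eval h \<omega> = 0" for h
  proof -
    obtain a q where aq: "a \<noteq> 0" "smult a h = g * q + pseudo_mod h g"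
      using pseudo_mod(1)[OF g0] by blast
    have "int_eval (smult a h) \<omega> = int_eval (g * q + pseudo_mod h g) \<omega>" by (simp only: aq(2))
    then have "int_eval (pseudo_mod h g) \<omega> = 0" using that g by (simp add: Z_def)
    then have "pseudo_mod h g = 0"
      using pseudo_mod(2)[OF g0, of h] min[of "pseudo_mod h g"] by (metis Z_def not_less)
    then show ?thesis using aq by auto
  qed
  have "f dvd g"
  proof -
    obtain a q where aq: "a \<noteq> 0" "smult a f = g * q" using div assms(2) by blast
    have "f dvd g * q" using aq(2) by (metis dvd_smult dvd_refl)
    then consider "f dvd g" | "f dvd q" using prime prime_elem_dvd_mult_iff by blast
    then show ?thesis
    proof cases
      case 2
      then obtain q' where q': "q = f * q'" ..
      have "f * [:a:] = f * (g * q')" using aq(2) q' by (simp add: ac_simps)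
      then have "[:a:] = g * q'" using f0 mult_left_cancel by blast
      then have "int_eval [:a:] \<omega> = 0" using g by (simp add: Z_def)
      then show ?thesis using aq(1) by simp
    qed
  qed
  obtain a q where aq: "a \<noteq> 0" "smult a P = g * q" using div assms(3) by blast
  have "f dvd [:a:] * P" using aq(2) \<open>f dvd g\<close> by simp
  then show ?thesis using prime no_const[OF aq(1)] prime_elem_dvd_mult_iff by blast
qed

lemma irreducible_factor_annihilator:
  fixes \<omega> :: "'a::field_char_0"
  assumes "int_eval Q \<omega> = 0" "Q \<noteq> 0"
  shows "\<exists>f. irreducible f \<and> f dvd Q \<and> int_eval f \<omega> = 0"
proof -
  have prod: "int_eval (prod_mset A) \<omega> = 0 \<Longrightarrow> \<exists>f\<in>#A. int_eval f \<omega> = 0" for A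
    by (induction A) auto
  have "int_eval (prod_mset (prime_factorization Q)) \<omega> = 0"
  proof -
    have "Q dvd prod_mset (prime_factorization Q)"
      using prod_mset_prime_factorization_weak[OF assms(2)] by (metis dvd_normalize_iff dvd_refl)
    then obtain h where "prod_mset (prime_factorization Q) = Q * h" ..
    then show ?thesis using assms(1) by simp
  qed
  then obtain f where f: "f \<in># prime_factorization Q" "int_eval f \<omega> = 0"
    using prod by blast
  then show ?thesis
    using in_prime_factors_imp_prime in_prime_factors_imp_dvd prime_imp_prime_elem
      prime_elem_imp_irreducible by blast
qed

text \<open>
  Let \<open>f\<close> be the minimal polynomial of \<open>\<omega>\<close>; it divides \<open>P\<close>, and \<open>X^N - 1 = f h\<close>. If \<open>f(\<omega>^p) \<noteq> 0\<close>, then \<open>h(\<omega>^p) = 0\<close>, and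
  the derivative at \<open>\<omega>^p\<close> gives \<open>N \<omega>^(p(N-1)) = f(\<omega>^p) h'(\<omega>^p)\<close>. Since \<open>f(\<omega>^p)\<close> is congruent to
  \<open>f(\<omega>)^p = 0\<close> modulo \<open>p\<close>, the integer \<open>N\<close> is divisible by \<open>p\<close> in \<open>\<int>[\<omega>]\<close>. This ring is free over
  the integers with basis \<open>1, \<omega>, ...\<close>, so \<open>p\<close> divides \<open>N\<close>.
\<close>

lemma int_poly_conjugate_prime_exponent:
  fixes \<omega> :: "'a::field_char_0" and P :: "int poly"
  assumes "prime p" "\<not> p dvd N" "N > 0" "\<omega> ^ N = 1" "int_eval P \<omega> = 0"
  shows "int_eval P (\<omega> ^ p) = 0"
proof (rule ccontr)
  assume P: "int_eval P (\<omega> ^ p) \<noteq> 0"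
  define Q :: "int poly" where "Q = monom 1 N - 1"
  have "coeff Q 0 = - 1" using assms(3) by (simp add: Q_def)
  then have Q0: "Q \<noteq> 0" by auto
  have Qroot: "int_eval Q z = z ^ N - 1" for z :: 'a by (simp add: Q_def)
  obtain f where f: "irreducible f" "f dvd Q" "int_eval f \<omega> = 0"
    using irreducible_factor_annihilator[OF _ Q0, of \<omega>] assms(4) by (auto simp: Qroot)
  obtain h where h: "Q = f * h" using f(2) ..
  have f0: "f \<noteq> 0" using f(1) by auto
  have "f dvd P" using irreducible_annihilator_dvd f assms(5) by blast
  then have fp: "int_eval f (\<omega> ^ p) \<noteq> 0" using P by (auto elim!: dvdE)
  have "(\<omega> ^ p) ^ N = 1" using assms(4) by (metis mult.commute power_mult power_one)
  then have "int_eval Q (\<omega> ^ p) = 0" by (simp add: Qroot)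
  then have hp: "int_eval h (\<omega> ^ p) = 0" using fp by (simp add: h)
  obtain g where g: "\<And>z::'a. int_eval f (z ^ p) = int_eval f z ^ p + of_nat p * int_eval g z"
    using int_eval_frobenius[OF assms(1)] by blast
  have p0: "p > 0" using assms(1) prime_gt_0_nat by blast
  have fp': "int_eval f (\<omega> ^ p) = of_nat p * int_eval g \<omega>"
    using g[of \<omega>] f(3) p0 by simp
  \<comment> \<open>The value \<open>h'(\<omega>^p)\<close> also lies in \<open>\<int>[\<omega>]\<close>.\<close>
  obtain g' where g': "\<And>z::'a. int_eval (pderiv h) (z ^ p) = int_eval g' z"
  proof -
    obtain k where k: "\<And>z::'a. int_eval (pderiv h) (z ^ p)
        = int_eval (pderiv h) z ^ p + of_nat p * int_eval k z"
      using int_eval_frobenius[OF assms(1)] by blast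
    have "\<And>z::'a. int_eval (pderiv h) (z ^ p) = int_eval (pderiv h ^ p + smult (int p) k) z"
      by (simp add: k)
    then show ?thesis using that by blast
  qed
  define G where "G = g * g' * monom 1 p"
  have "int_eval (pderiv Q) (\<omega> ^ p) = int_eval f (\<omega> ^ p) * int_eval (pderiv h) (\<omega> ^ p)"
    by (simp add: h pderiv_mult hp)
  moreover have "int_eval (pderiv Q) (\<omega> ^ p) * \<omega> ^ p = of_nat N"
  proof -
    have "(\<omega> ^ p) ^ (N - 1) * \<omega> ^ p = (\<omega> ^ p) ^ N"
      using assms(3) by (metis power_minus_mult)
    then show ?thesis
      unfolding Q_def int_eval_pderiv_unit_power using \<open>(\<omega> ^ p) ^ N = 1\<close> by (simp add: mult.assoc)
  qed
  ultimately have N: "of_nat N = of_nat p * int_eval G \<omega>"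
    by (simp add: fp' g' G_def mult_ac)
  \<comment> \<open>Since \<open>f\<close> is monic up to sign, pseudo-division by \<open>f\<close> multiplies \<open>G\<close> only by a sign \<open>u\<close>.\<close>
  have lead: "lead_coeff f = 1 \<or> lead_coeff f = - 1"
  proof -
    have "lead_coeff Q = 1"
    proof -
      have "degree Q = N"
        unfolding Q_def diff_conv_add_uminus using assms(3)
        by (subst degree_add_eq_left) (simp_all add: degree_monom_eq)
      then show ?thesis using assms(3) by (simp add: Q_def)
    qed
    then have "lead_coeff f * lead_coeff h = 1" by (simp add: h lead_coeff_mult)
    then show ?thesis by (metis zmult_eq_1_iff)
  qed
  obtain q r where qr: "pseudo_divmod G f = (q, r)" by fastforce
  define u where "u = lead_coeff f ^ (Suc (degree G) - degree f)"
  have u: "u = 1 \<or> u = - 1"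
  proof -
    have "(- 1 :: int) ^ k = 1 \<or> (- 1 :: int) ^ k = - 1" for k by (cases "even k") auto
    then show ?thesis using lead unfolding u_def by (metis power_one)
  qed
  have div: "smult u G = f * q + r" "r = 0 \<or> degree r < degree f"
    using pseudo_divmod[OF f0 qr] by (auto simp: u_def)
  have "of_int u * int_eval G \<omega> = int_eval r \<omega>"
    using arg_cong[OF div(1), of "\<lambda>x. int_eval x \<omega>"] f(3) by simp
  then have "int_eval ([:u * int N:] - smult (int p) r) \<omega> = 0"
    using N by (simp add: mult_ac)
  then have dvd: "f dvd [:u * int N:] - smult (int p) r"
    using irreducible_annihilator_dvd[OF f(1,3)] by blast
  have "degree f > 0"
  proof (rule ccontr)
    assume "\<not> degree f > 0"
    then obtain c where "f = [:c:]" by (auto elim: degree_eq_zeroE)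
    then show False using f0 f(3) by simp
  qed
  then have "degree ([:u * int N:] - smult (int p) r) < degree f"
    using div(2) by (intro degree_diff_less) (auto intro: le_less_trans[OF degree_smult_le])
  then have "[:u * int N:] - smult (int p) r = 0"
    using dvd f0 by (metis dvd_imp_degree_le not_less)
  then have "coeff ([:u * int N:] - smult (int p) r) 0 = 0" by simp
  then have "u * int N = int p * coeff r 0" by simp
  then have "int N = int p * (u * coeff r 0)" using u by auto
  then have "int p dvd int N" by (metis dvd_triv_left)
  then show False using assms(2) by simp
qed

text \<open>
  The exponent \<open>u\<close> is reached one prime factor at a time.
\<close>

lemma int_poly_conjugate_root_of_unity:
  fixes \<omega> :: "'a::field_char_0" and P :: "int poly"
  assumes "coprime u N" "N > 0" "u > 0" "\<omega> ^ N = 1" "int_eval P \<omega> = 0"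
  shows "int_eval P (\<omega> ^ u) = 0"
  using assms
proof (induction u arbitrary: \<omega> rule: less_induct)
  case (less u)
  show ?case
  proof (cases "u = 1")
    case True
    then show ?thesis using less.prems by simp
  next
    case False
    then obtain p where p: "prime p" "p dvd u" using prime_factor_nat by blast
    then obtain k where k: "u = p * k" by blast
    have "\<not> p dvd N"
      using p less.prems(1) by (metis coprime_common_divisor_nat not_prime_1)
    then have "int_eval P (\<omega> ^ p) = 0"
      using int_poly_conjugate_prime_exponent p(1) less.prems by blast
    moreover have "(\<omega> ^ p) ^ N = 1"
      using less.prems(4) by (metis mult.commute power_mult power_one)
    moreover have "k < u" "k > 0" using k less.prems(3) p(1) prime_gt_1_nat by auto
    moreover have "coprime k N" using less.prems(1) k by simp
    ultimately have "int_eval P ((\<omega> ^ p) ^ k) = 0"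
      using less.IH less.prems(2) by blast
    then show ?thesis by (simp add: k power_mult)
  qed
qed

lemma mask_lambda_int_eval:
  "mask_lambda \<zeta> M j = int_eval (\<Sum>a\<in>M. monom 1 a) (\<zeta> ^ j)"
  by (simp add: mask_lambda_def mult.commute flip: power_mult)

text \<open>
  Proportionality is expressed by the vanishing of minors and, if the first vector is zero, of the
  second vector. Both are relations over the integers; the zero case passes from \<open>\<omega>^u\<close> back to \<open>\<omega>\<close>
  with the inverse exponent \<open>v\<close> of \<open>u\<close> modulo \<open>N\<close>.
\<close>

lemma proportional_conjugate:
  fixes \<omega> :: "'a::field_char_0" and P Q :: "nat \<Rightarrow> int poly"
  assumes "coprime u N" "N > 0" "u > 0" "\<omega> ^ N = 1"
    and ST: "\<exists>c. \<forall>\<nu><t. int_eval (Q \<nu>) \<omega> = c * int_eval (P \<nu>) \<omega>"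
  shows "\<exists>c. \<forall>\<nu><t. int_eval (Q \<nu>) (\<omega> ^ u) = c * int_eval (P \<nu>) (\<omega> ^ u)"
proof -
  have conj: "int_eval F (\<omega> ^ u) = 0" if "int_eval F \<omega> = 0" for F
    using int_poly_conjugate_root_of_unity assms(1-4) that by blast
  obtain c where c: "\<And>\<nu>. \<nu> < t \<Longrightarrow> int_eval (Q \<nu>) \<omega> = c * int_eval (P \<nu>) \<omega>" using ST by blast
  have minor: "int_eval (Q \<nu>) (\<omega> ^ u) * int_eval (P \<mu>) (\<omega> ^ u)
      = int_eval (Q \<mu>) (\<omega> ^ u) * int_eval (P \<nu>) (\<omega> ^ u)" if "\<mu> < t" "\<nu> < t" for \<mu> \<nu>
    using conj[of "Q \<nu> * P \<mu> - Q \<mu> * P \<nu>"] by (simp add: c that)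
  show ?thesis
  proof (cases "\<exists>\<mu><t. int_eval (P \<mu>) (\<omega> ^ u) \<noteq> 0")
    case True
    then obtain \<mu> where \<mu>: "\<mu> < t" "int_eval (P \<mu>) (\<omega> ^ u) \<noteq> 0" by blast
    then show ?thesis
      using minor[OF \<mu>(1)]
      by (intro exI[of _ "int_eval (Q \<mu>) (\<omega> ^ u) / int_eval (P \<mu>) (\<omega> ^ u)"]) (simp add: field_simps)
  next
    case False
    obtain v y where vy: "u * v = N * y + gcd u N" using bezout_nat[of u N] assms(3) by blast
    then have uv: "u * v = N * y + 1" using assms(1) by simp
    have inv: "(\<omega> ^ u) ^ v = \<omega>"
    proof -
      have "(\<omega> ^ u) ^ v = \<omega> ^ (u * v)" by (simp add: power_mult)
      then show ?thesis unfolding uv using assms(4) by (simp add: power_add power_mult)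
    qed
    have "v > 0" using uv by (cases v) auto
    have "coprime v N"
    proof (rule coprimeI)
      fix k assume "k dvd v" "k dvd N"
      then have "k dvd N * y + 1" "k dvd N * y" using uv by (metis dvd_mult, simp)
      then show "k dvd 1" by (metis dvd_add_right_iff)
    qed
    have "(\<omega> ^ u) ^ N = 1" using assms(4) by (metis mult.commute power_mult power_one)
    have "int_eval (P \<nu>) \<omega> = 0" if "\<nu> < t" for \<nu>
      using int_poly_conjugate_root_of_unity[OF \<open>coprime v N\<close> assms(2) \<open>v > 0\<close> \<open>(\<omega> ^ u) ^ N = 1\<close>, of "P \<nu>"]
        False that inv by auto
    then have "int_eval (Q \<nu>) (\<omega> ^ u) = 0" if "\<nu> < t" for \<nu>
      using conj[of "Q \<nu>"] c that by simp
    then show ?thesis by (intro exI[of _ 0]) simp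
  qed
qed

lemma lambda_line_eq_conjugate:
  fixes \<zeta> :: "'a::field_char_0"
  assumes \<zeta>: "primitive_root_of_unity d \<zeta>"
    and len: "length S = length n" "length T = length n"
    and j: "0 < j" "j < d"
    and eq: "lambda_line \<zeta> S (gcd j d) = lambda_line \<zeta> T (gcd j d)"
  shows "lambda_line \<zeta> S j = lambda_line \<zeta> T j"
proof -
  let ?g = "gcd j d" and ?P = "\<lambda>A \<nu>. \<Sum>a\<in>A ! \<nu>. monom 1 a :: int poly"
  have g: "?g > 0" using j by simp
  have j_eq: "?g * (j div ?g) = j" and d_eq: "?g * (d div ?g) = d" by simp_all
  have pos: "j div ?g > 0" "d div ?g > 0" using j by (auto simp: div_greater_zero_iff gcd_le1_nat gcd_le2_nat)
  have cop: "coprime (j div ?g) (d div ?g)" using j by (intro div_gcd_coprime) auto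
  have one: "(\<zeta> ^ ?g) ^ (d div ?g) = 1"
    using \<zeta> unfolding power_mult[symmetric] d_eq by (simp add: primitive_root_of_unity_def)
  have pow: "(\<zeta> ^ ?g) ^ (j div ?g) = \<zeta> ^ j"
    unfolding power_mult[symmetric] j_eq ..
  have "\<exists>c. \<forall>\<nu><length n. mask_lambda \<zeta> (B ! \<nu>) j = c * mask_lambda \<zeta> (A ! \<nu>) j"
    if "\<exists>c. \<forall>\<nu><length n. mask_lambda \<zeta> (B ! \<nu>) ?g = c * mask_lambda \<zeta> (A ! \<nu>) ?g" for A B
    using proportional_conjugate[OF cop pos(2,1) one, of "length n" "?P B" "?P A"] that
    unfolding mask_lambda_int_eval pow by blast
  then show ?thesis using eq unfolding lambda_line_eq_iff[OF len] by blast
qed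

lemma proper_divisor_le_b_bound:
  assumes "g dvd d" "0 < g" "g < d"
  shows "g \<le> b_bound d"
proof -
  let ?p = "Min (prime_factors d)"
  obtain k where k: "d = g * k" using assms(1) ..
  have "k \<noteq> 0" "k \<noteq> 1" using assms(2,3) k by auto
  then have "k > 1" by simp
  obtain q where q: "prime q" "q dvd k" using prime_factor_nat[OF \<open>k \<noteq> 1\<close>] by blast
  have "q \<in> prime_factors d" using q k assms by (auto simp: prime_factors_dvd)
  then have "?p \<le> q" "?p \<in> prime_factors d" by (auto intro: Min_in)
  then have "?p > 0" using prime_gt_0_nat by (metis in_prime_factors_imp_prime)
  have "q \<le> k" using q(2) \<open>k > 1\<close> by (intro dvd_imp_le) auto
  then have "g * ?p \<le> d" using \<open>?p \<le> q\<close> k by simp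
  then show ?thesis
    unfolding b_bound_def using \<open>?p > 0\<close> by (simp add: less_eq_div_iff_mult_less_eq)
qed

section \<open>Lines and isomorphisms\<close>

lemma mask_lambda_0: "mask_lambda \<zeta> M 0 = of_nat (card M)"
  by (simp add: mask_lambda_def)

lemma mask_lambda_period:
  assumes "primitive_root_of_unity d \<zeta>"
  shows "mask_lambda \<zeta> M d = mask_lambda \<zeta> M 0"
proof -
  have "\<zeta> ^ (a * d) = 1" for a
    using assms by (metis mult.commute power_mult power_one primitive_root_of_unity_def)
  then show ?thesis by (simp add: mask_lambda_def)
qed

lemma lambda_line_0_proportional:
  fixes \<zeta> :: "'a::field_char_0" and c :: rat
  assumes "length S = length n" "length T = length n"
    and "c > 0" "\<forall>\<nu><length n. of_nat (card (S ! \<nu>)) = c * of_nat (card (T ! \<nu>))"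
  shows "lambda_line \<zeta> S 0 = lambda_line \<zeta> T 0"
proof -
  have "(of_nat (card (S ! \<nu>)) :: 'a) = of_rat c * of_nat (card (T ! \<nu>))" if "\<nu> < length n" for \<nu>
  proof -
    have "(of_rat (of_nat (card (S ! \<nu>))) :: 'a) = of_rat (c * of_nat (card (T ! \<nu>)))"
      using assms(4) that by simp
    then show ?thesis by (simp add: of_rat_mult)
  qed
  note 1 = this
  have "(of_nat (card (T ! \<nu>)) :: 'a) = inverse (of_rat c) * of_nat (card (S ! \<nu>))" if "\<nu> < length n" for \<nu>
    using 1[OF that] assms(3) by simp
  then show ?thesis
    unfolding lambda_line_eq_iff[OF assms(1,2)] mask_lambda_0 using 1 by blast
qed

theorem theorem4p1:
  fixes \<zeta> :: "'a :: {alg_closed_field, field_char_0}"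
    and d :: nat and n :: "nat list" and S T :: "nat set list"
  assumes "d \<ge> 2"
    and "primitive_root_of_unity d \<zeta>"
    and "length S = length n" and "length T = length n"
    and "mask_list d S" and "mask_list d T"
    and "\<forall>\<nu><length n. n ! \<nu> > 0"
  shows "((\<forall>j<d. lambda_line \<zeta> S j = lambda_line \<zeta> T j) \<longrightarrow>
           (\<exists>!\<phi>. \<phi> \<in> extensional (mask_variety \<zeta> n S) \<and> compatible_iso \<zeta> n S T \<phi>)) \<and>
         ((\<forall>\<nu><length n. n ! \<nu> \<ge> d) \<longrightarrow>
           (\<exists>\<phi>. compatible_iso \<zeta> n S T \<phi>) \<longrightarrow>
           (\<forall>j<d. lambda_line \<zeta> S j = lambda_line \<zeta> T j)) \<and>
         ((\<exists>c::rat. c > 0 \<and> (\<forall>\<nu><length n. of_nat (card (S ! \<nu>)) = c * of_nat (card (T ! \<nu>)))) \<longrightarrow>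
           (\<forall>\<nu><length n. n ! \<nu> \<ge> b_bound d) \<longrightarrow>
           (\<exists>\<phi>. compatible_iso \<zeta> n S T \<phi>) \<longrightarrow>
           (\<forall>j<d. lambda_line \<zeta> S j = lambda_line \<zeta> T j))"
proof (intro conjI impI allI)
  have d: "d > 0" using assms(1) by simp
  note len = assms(3,4)
  have z: "\<zeta> \<noteq> 0" using primitive_root_nonzero[OF assms(2) d] .
  have masks: "finite M \<and> M \<noteq> {}" if "M \<in> set S \<union> set T" for M
    using assms(5,6) that finite_subset[of M "{..<d}"] by (auto simp: mask_list_def)
  then have fin: "\<And>M. M \<in> set S \<Longrightarrow> finite M" "\<And>M. M \<in> set T \<Longrightarrow> finite M" by auto
  note converse = compatible_iso_imp_lambda_line_eq[OF z len masks]
  {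
    assume "\<forall>j<d. lambda_line \<zeta> S j = lambda_line \<zeta> T j"
    then have lines: "\<And>j. j < d \<Longrightarrow> \<exists>c. \<forall>\<nu><length n. mask_lambda \<zeta> (T ! \<nu>) j = c * mask_lambda \<zeta> (S ! \<nu>) j"
      "\<And>j. j < d \<Longrightarrow> \<exists>c. \<forall>\<nu><length n. mask_lambda \<zeta> (S ! \<nu>) j = c * mask_lambda \<zeta> (T ! \<nu>) j"
      unfolding lambda_line_eq_iff[OF len] by blast+
    show "\<exists>!\<phi>. \<phi> \<in> extensional (mask_variety \<zeta> n S) \<and> compatible_iso \<zeta> n S T \<phi>"
      by (rule compatible_iso_unique_existence[OF assms(2) d len fin lines])
  next
    fix j assume n: "\<forall>\<nu><length n. n ! \<nu> \<ge> d" and "\<exists>\<phi>. compatible_iso \<zeta> n S T \<phi>" and j: "j < d"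
    then obtain \<phi> where \<phi>: "compatible_iso \<zeta> n S T \<phi>" by blast
    show "lambda_line \<zeta> S j = lambda_line \<zeta> T j"
    proof (cases "j = 0")
      case True
      \<comment> \<open>The frequency \<open>0\<close> is reached as \<open>d\<close>, where the curve argument applies.\<close>
      have "lambda_line \<zeta> S d = lambda_line \<zeta> T d"
        using n d by (intro converse[OF _ _ _ \<phi>]) auto
      then show ?thesis
        unfolding True lambda_line_def mask_lambda_period[OF assms(2)] .
    next
      case False
      have "j \<le> n ! \<nu>" if "\<nu> < length n" for \<nu> using n j that by (meson less_imp_le order_trans)
      then show ?thesis using False by (intro converse[OF _ _ _ \<phi>]) auto
    qed
  next
    fix j
    assume weights: "\<exists>c::rat. c > 0 \<and> (\<forall>\<nu><length n. of_nat (card (S ! \<nu>)) = c * of_nat (card (T ! \<nu>)))"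
      and n: "\<forall>\<nu><length n. n ! \<nu> \<ge> b_bound d" and "\<exists>\<phi>. compatible_iso \<zeta> n S T \<phi>" and j: "j < d"
    then obtain \<phi> where \<phi>: "compatible_iso \<zeta> n S T \<phi>" by blast
    show "lambda_line \<zeta> S j = lambda_line \<zeta> T j"
    proof (cases "j = 0")
      case True
      then show ?thesis using weights lambda_line_0_proportional[OF len] by blast
    next
      case False
      have g: "gcd j d \<ge> 1" "gcd j d \<le> b_bound d"
      proof -
        show "gcd j d \<ge> 1" using False by (simp add: Suc_le_eq)
        have "gcd j d \<le> j" using False by (intro gcd_le1_nat)
        then have "gcd j d < d" using j by simp
        then show "gcd j d \<le> b_bound d" using d by (intro proper_divisor_le_b_bound) auto
      qed
      have "gcd j d \<le> n ! \<nu>" if "\<nu> < length n" for \<nu> using n g(2) that by (meson order_trans)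
      then have "lambda_line \<zeta> S (gcd j d) = lambda_line \<zeta> T (gcd j d)"
        using g(1) by (intro converse[OF _ _ _ \<phi>]) auto
      then show ?thesis using lambda_line_eq_conjugate[OF assms(2) len _ j] False by simp
    qed
  }
qed

end
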